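(* Let $n\ge 2$ be an integer, let $0<m\le n$, and let $v_0,\dots,v_n$ be real numbers with $v_0,\dots,v_{m-1}\ge 0$, $v_m,\dots,v_n\le 0$, $v_0>0$, $v_n<0$ and $v_0+\dots+v_n>0$. Then for almost every $x\in\mathbb{R}$ there are only finitely many $Q\in\mathbb{N}$ such that $$|P^{(i)}(x)|<Q^{-v_i}\quad(0\le i\le n)\qquad\text{for some }P\in\mathbb{Z}[x]\setminus\{0\},\ \deg P\le n.$$
   Context: $P^{(i)}$ denotes the $i$-th derivative of $P$ (with $P^{(0)}=P$). "Almost every" is with respect to Lebesgue measure on $\mathbb{R}$. *)

theory Defs
  imports "HOL-Analysis.Analysis" "HOL-Computational_Algebra.Polynomial"
begin

end

theory Submission
  imports
    Defs
    "HOL-Computational_Algebra.Fundamental_Theorem_Algebra"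
    "Jordan_Normal_Form.Determinant"
begin

hide_const (open) module.smult

text \<open>
  The proof is the quantitative nondivergence argument of Kleinbock and Margulis, in the form that
  it takes for polynomials in one variable.

  Fix \<open>Q\<close> and give the derivative of order \<open>i\<close> the weight \<open>w\<^sub>i = Q powr v\<^sub>i / R\<close>. A polynomial that
  satisfies the system of inequalities at \<open>x\<close> has all its weighted derivatives at \<open>x\<close> below \<open>1 / R\<close>.
  In other words, the lattice of the vectors \<open>(w\<^sub>0 P(x), w\<^sub>1 P'(x), \<dots>)\<close>, with \<open>P\<close> integral of degree
  at most \<open>n\<close>, contains a short nonzero vector. For a subspace \<open>V\<close> spanned by integral polynomials,
  let \<open>\<psi>\<^sub>V(x)\<close> be the sum of the squares of the weighted maximal minors of the matrix of derivatives
  of a basis of \<open>V\<close>. It measures the covolume of the part of the lattice that lies in \<open>V\<close>, and it is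
  a polynomial in \<open>x\<close> of bounded degree.

  Two facts about \<open>\<psi>\<^sub>V\<close> carry the argument. One is a lower bound for its supremum over a fixed
  interval \<open>[a, b]\<close>: the minor formed by the first \<open>k\<close> derivatives is the Wronskian, a nonzero
  polynomial with integer coefficients (\<open>wronskian_nonzero\<close>), and such polynomials of bounded degree
  cannot be uniformly small on \<open>[a, b]\<close> (\<open>integral_poly_sup_bound\<close>). Its weight is
  \<open>Q powr (v\<^sub>0 + \<dots> + v\<^bsub>k-1\<^esub>) / R ^ k\<close>. The sign pattern of \<open>v\<close> makes every such partial sum positive
  (\<open>partial_sums_pos\<close>), so \<open>R\<close> can be taken to be a constant times a positive power of \<open>Q\<close>, and
  for large \<open>Q\<close> still every \<open>\<psi>\<^sub>V\<close> reaches the value 1 on \<open>[a, b]\<close>. The other fact is that a polynomial of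
  degree at most \<open>D\<close> which reaches 1 on an interval is below \<open>\<delta> ^ D\<close> only on a part of relative size
  \<open>O(\<delta>)\<close> (\<open>poly_sublevel_measure\<close>).

  These are combined by an induction on flags of subspaces (\<open>unmarked_measure\<close>). Outside a set of
  measure \<open>O(\<delta>)\<close>, each point \<open>x\<close> carries a flag of subspaces with \<open>\<delta> ^ D \<le> \<psi>\<^sub>V(x) \<le> 1\<close> such that
  \<open>\<psi>\<^sub>W(x) \<ge> 1\<close> for every other \<open>W\<close> comparable with the whole flag. At such a point no lattice vector is
  short (\<open>marked_imp_no_small_vector\<close>): adjoining a short vector to a suitable member of the flag
  would produce a subspace that is comparable with the flag and has too small a covolume.

  For \<open>Q = 2 ^ j\<close> this bounds the measure of the exceptional set by a geometric sequence in \<open>j\<close>,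
  and the Borel--Cantelli lemma applies. A value of \<open>Q\<close> between two powers of 2 only costs a constant
  factor in the inequalities.
\<close>


section \<open>Small values of polynomials on an interval\<close>

text \<open>
  Over the complex numbers the polynomial splits. The distances from \<open>x\<close> to the complex roots
  control its size in both estimates below.
\<close>

lemma abs_poly_eq_prod_dist_roots:
  fixes p :: "real poly"
  obtains z :: "nat \<Rightarrow> complex" where
    "\<And>x. \<bar>poly p x\<bar> = \<bar>lead_coeff p\<bar> * (\<Prod>i<degree p. cmod (of_real x - z i))"
proof -
  define q :: "complex poly" where "q = map_poly of_real p"
  obtain z where z: "smult (lead_coeff q) (\<Prod>i<degree q. [:- z i, 1:]) = q"
    using complex_poly_decompose' by metis
  have deg: "degree q = degree p" unfolding q_def by (simp add: degree_map_poly)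
  have lc: "lead_coeff q = of_real (lead_coeff p)" unfolding deg by (simp add: q_def coeff_map_poly)
  have "\<bar>poly p x\<bar> = \<bar>lead_coeff p\<bar> * (\<Prod>i<degree p. cmod (of_real x - z i))" for x
  proof -
    have "poly q (of_real x) = lead_coeff q * (\<Prod>i<degree p. of_real x - z i)"
      by (subst z[symmetric]) (simp add: poly_prod deg)
    moreover have "poly q (of_real x) = of_real (poly p x)"
      unfolding q_def by (induction p) (auto simp: map_poly_pCons)
    ultimately have "cmod (of_real (poly p x)) = cmod (lead_coeff q * (\<Prod>i<degree p. of_real x - z i))"
      by simp
    then show ?thesis unfolding lc by (simp add: norm_mult prod_norm)
  qed
  then show ?thesis using that by blast
qed

text \<open>
  If \<open>p\<close> is much smaller at \<open>x\<close> than at \<open>y\<close>, then some root \<open>z\<close> is much closer to \<open>x\<close> than to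
  \<open>y\<close>. As \<open>x\<close> and \<open>y\<close> are at distance at most \<open>d - c\<close>, the root lies within \<open>2 \<delta> (d - c)\<close> of \<open>x\<close>.
  Hence \<open>x\<close> is confined to at most \<open>D\<close> short intervals around the real parts of the roots.
\<close>

lemma poly_sublevel_measure:
  fixes p :: "real poly"
  assumes deg: "degree p \<le> D" and y: "y \<in> {c..d}" "1 \<le> \<bar>poly p y\<bar>"
    and \<delta>: "0 < \<delta>" "\<delta> \<le> 1/2"
  shows "emeasure lborel {x\<in>{c..d}. \<bar>poly p x\<bar> < \<delta> ^ D} \<le> ennreal (4 * real D * \<delta> * (d - c))"
proof -
  obtain z where z: "\<And>x. \<bar>poly p x\<bar> = \<bar>lead_coeff p\<bar> * (\<Prod>i<degree p. cmod (of_real x - z i))"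
    using abs_poly_eq_prod_dist_roots by blast
  define h where "h = 2 * \<delta> * (d - c)"
  have h0: "0 \<le> h" unfolding h_def using y \<delta> by auto
  have sub: "{x\<in>{c..d}. \<bar>poly p x\<bar> < \<delta> ^ D} \<subseteq> (\<Union>i<degree p. {Re (z i) - h..Re (z i) + h})"
  proof
    fix x assume x: "x \<in> {x\<in>{c..d}. \<bar>poly p x\<bar> < \<delta> ^ D}"
    have "\<exists>i<degree p. cmod (of_real x - z i) < \<delta> * cmod (of_real y - z i)"
    proof (rule ccontr)
      assume "\<not> ?thesis"
      then have "\<delta> * cmod (of_real y - z i) \<le> cmod (of_real x - z i)" if "i < degree p" for i
        using that not_less by blast
      then have "(\<Prod>i<degree p. \<delta> * cmod (of_real y - z i)) \<le> (\<Prod>i<degree p. cmod (of_real x - z i))"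
        using \<delta> by (intro prod_mono) auto
      then have "\<delta> ^ degree p * (\<Prod>i<degree p. cmod (of_real y - z i)) \<le> (\<Prod>i<degree p. cmod (of_real x - z i))"
        by (simp add: prod.distrib)
      then have "\<bar>lead_coeff p\<bar> * (\<delta> ^ degree p * (\<Prod>i<degree p. cmod (of_real y - z i))) \<le> \<bar>poly p x\<bar>"
        unfolding z by (intro mult_left_mono) auto
      then have "\<delta> ^ degree p * \<bar>poly p y\<bar> \<le> \<bar>poly p x\<bar>"
        unfolding z[of y] by (simp add: mult_ac)
      moreover have "\<delta> ^ D \<le> \<delta> ^ degree p"
        using \<delta> deg by (intro power_decreasing) auto
      moreover have "\<delta> ^ degree p * 1 \<le> \<delta> ^ degree p * \<bar>poly p y\<bar>"
        using y \<delta> by (intro mult_left_mono) auto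
      ultimately show False using x by auto
    qed
    then obtain i where i: "i < degree p" "cmod (of_real x - z i) < \<delta> * cmod (of_real y - z i)" by blast
    have "cmod (of_real y - z i) \<le> cmod (of_real y - of_real x) + cmod (of_real x - z i)"
      by (metis add.commute diff_add_cancel add_diff_eq norm_triangle_ineq)
    also have "cmod (of_real y - of_real x) = \<bar>y - x\<bar>"
      by (metis norm_of_real of_real_diff)
    also have "\<bar>y - x\<bar> \<le> d - c" using x y by auto
    finally have "\<delta> * cmod (of_real y - z i) \<le> \<delta> * ((d - c) + cmod (of_real x - z i))"
      using \<delta> by (intro mult_left_mono) auto
    moreover have "\<delta> * cmod (of_real x - z i) \<le> 1/2 * cmod (of_real x - z i)"
      using \<delta> by (intro mult_right_mono) auto
    ultimately have "cmod (of_real x - z i) \<le> h"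
      using i(2) unfolding h_def by (simp add: algebra_simps)
    moreover have "\<bar>x - Re (z i)\<bar> \<le> cmod (of_real x - z i)"
      using abs_Re_le_cmod[of "of_real x - z i"] by simp
    ultimately show "x \<in> (\<Union>i<degree p. {Re (z i) - h..Re (z i) + h})"
      using i(1) by (auto simp: abs_le_iff intro!: bexI[of _ i])
  qed
  have "emeasure lborel {x\<in>{c..d}. \<bar>poly p x\<bar> < \<delta> ^ D}
      \<le> emeasure lborel (\<Union>i<degree p. {Re (z i) - h..Re (z i) + h})"
    by (rule emeasure_mono[OF sub]) auto
  also have "\<dots> \<le> (\<Sum>i<degree p. emeasure lborel {Re (z i) - h..Re (z i) + h})"
    by (rule emeasure_subadditive_finite) auto
  also have "\<dots> = (\<Sum>i<degree p. ennreal (2 * h))"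
    using h0 by (intro sum.cong) auto
  also have "\<dots> = ennreal (degree p * (2 * h))"
    using h0 by (simp add: ennreal_mult ennreal_of_nat_eq_real_of_nat)
  also have "\<dots> \<le> ennreal (4 * real D * \<delta> * (d - c))"
  proof (rule ennreal_leI)
    have "degree p * (2 * h) \<le> D * (2 * h)" using deg h0 by (intro mult_right_mono) auto
    then show "degree p * (2 * h) \<le> 4 * real D * \<delta> * (d - c)" by (simp add: h_def mult_ac)
  qed
  finally show ?thesis .
qed

text \<open>
  The leading coefficient of a nonzero polynomial with integer coefficients has absolute value at
  least 1, so the polynomial is small only near one of its at most \<open>D\<close> roots, and short
  neighbourhoods of so few points cannot cover \<open>[a, b]\<close>. The bound \<open>\<eta>\<close> does not depend on the
  polynomial.
\<close>

lemma integral_poly_sup_bound: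
  fixes a b :: real
  assumes "a < b"
  obtains \<eta> :: real where "0 < \<eta>" "\<eta> \<le> 1"
    "\<And>p. p \<noteq> 0 \<Longrightarrow> (\<forall>i. coeff p i \<in> \<int>) \<Longrightarrow> degree p \<le> D \<Longrightarrow> \<exists>y\<in>{a..b}. \<eta> \<le> \<bar>poly p y\<bar>"
proof -
  define t where "t = min 1 ((b - a) / (4 * (D + 1)))"
  have t: "0 < t" "t \<le> 1" and t2: "t \<le> (b - a) / (4 * (D + 1))" unfolding t_def using assms by auto
  have t3: "2 * t * D < b - a"
  proof -
    have "t * (4 * (D + 1)) \<le> b - a" using t2 by (simp add: field_simps)
    moreover have "2 * t * D < t * (4 * (D + 1))" using t by (simp add: algebra_simps add_strict_increasing)
    ultimately show ?thesis by linarith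
  qed
  have main: "\<exists>y\<in>{a..b}. t ^ D \<le> \<bar>poly p y\<bar>"
    if p: "p \<noteq> 0" "\<forall>i. coeff p i \<in> \<int>" "degree p \<le> D" for p
  proof (rule ccontr)
    assume neg: "\<not> ?thesis"
    obtain z where z: "\<And>x. \<bar>poly p x\<bar> = \<bar>lead_coeff p\<bar> * (\<Prod>i<degree p. cmod (of_real x - z i))"
      using abs_poly_eq_prod_dist_roots by blast
    have lc: "1 \<le> \<bar>lead_coeff p\<bar>"
      using p(1,2) by (metis Ints_nonzero_abs_ge1 leading_coeff_0_iff)
    have "{a..b} \<subseteq> (\<Union>i<degree p. {Re (z i) - t..Re (z i) + t})"
    proof
      fix x assume x: "x \<in> {a..b}"
      have "\<exists>i<degree p. cmod (of_real x - z i) < t"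
      proof (rule ccontr)
        assume "\<not> ?thesis"
        then have "t \<le> cmod (of_real x - z i)" if "i < degree p" for i
          using that not_less by blast
        then have "(\<Prod>i<degree p. t) \<le> (\<Prod>i<degree p. cmod (of_real x - z i))"
          using t by (intro prod_mono) auto
        then have "1 * t ^ degree p \<le> \<bar>poly p x\<bar>"
          unfolding z using lc t by (intro mult_mono) auto
        moreover have "t ^ D \<le> t ^ degree p"
          using t p(3) by (intro power_decreasing) auto
        ultimately have "t ^ D \<le> \<bar>poly p x\<bar>" by linarith
        then show False using neg x by blast
      qed
      then obtain i where i: "i < degree p" "cmod (of_real x - z i) < t" by blast
      have "\<bar>x - Re (z i)\<bar> \<le> cmod (of_real x - z i)"
        using abs_Re_le_cmod[of "of_real x - z i"] by simp
      then show "x \<in> (\<Union>i<degree p. {Re (z i) - t..Re (z i) + t})"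
        using i by (auto simp: abs_le_iff intro!: bexI[of _ i])
    qed
    then have "emeasure lborel {a..b} \<le> emeasure lborel (\<Union>i<degree p. {Re (z i) - t..Re (z i) + t})"
      by (rule emeasure_mono) auto
    also have "\<dots> \<le> (\<Sum>i<degree p. emeasure lborel {Re (z i) - t..Re (z i) + t})"
      by (rule emeasure_subadditive_finite) auto
    also have "\<dots> = (\<Sum>i<degree p. ennreal (2 * t))"
      using t by (intro sum.cong) auto
    also have "\<dots> = ennreal (degree p * (2 * t))"
      using t by (simp add: ennreal_mult ennreal_of_nat_eq_real_of_nat)
    finally have "b - a \<le> degree p * (2 * t)" using assms t by (simp add: ennreal_le_iff)
    also have "\<dots> \<le> D * (2 * t)" using p(3) t by (intro mult_right_mono) auto
    finally show False using t3 by (simp add: mult_ac)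
  qed
  show ?thesis
    by (rule that[of "t ^ D"]) (use t main in \<open>auto simp: power_le_one\<close>)
qed

section \<open>Maximal intervals on which a polynomial is small\<close>

text \<open>
  A subcover with the fewest intervals meets each point at most twice: among three intervals through
  a common point, the one reaching furthest left and the one reaching furthest right cover the third.
  Integrating this multiplicity bounds the total length.
\<close>

lemma interval_subcover_length:
  fixes F :: "(real \<times> real) set"
  assumes ab: "a \<le> b" and fin: "finite F" and F: "\<And>u v. (u, v) \<in> F \<Longrightarrow> a \<le> u \<and> u \<le> v \<and> v \<le> b"
  obtains G where "G \<subseteq> F" "(\<Union>(u,v)\<in>G. {u..v}) = (\<Union>(u,v)\<in>F. {u..v})"
    "(\<Sum>(u,v)\<in>G. v - u) \<le> 2 * (b - a)"
proof -
  define U where "U = (\<lambda>G :: (real \<times> real) set. \<Union>(u,v)\<in>G. {u..v})"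
  obtain G where G: "G \<subseteq> F \<and> U G = U F" and min: "\<And>H. H \<subseteq> F \<and> U H = U F \<Longrightarrow> card G \<le> card H"
    using ex_has_least_nat[of "\<lambda>G. G \<subseteq> F \<and> U G = U F" F card] by blast
  have finG: "finite G" using G fin finite_subset by blast
  have overlap: "card {J\<in>G. x \<in> {fst J..snd J}} \<le> 2" for x
  proof -
    define H where "H = {J\<in>G. x \<in> {fst J..snd J}}"
    have finH: "finite H" using finG by (simp add: H_def)
    show ?thesis
    proof (cases "H = {}")
      case False
      obtain l where l: "l \<in> H" "\<And>J. J \<in> H \<Longrightarrow> fst l \<le> fst J"
        using Min_in[of "fst ` H"] Min_le[of "fst ` H"] finH False by fastforce
      obtain r where r: "r \<in> H" "\<And>J. J \<in> H \<Longrightarrow> snd J \<le> snd r"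
        using Max_in[of "snd ` H"] Max_ge[of "snd ` H"] finH False by fastforce
      have "H \<subseteq> {l, r}"
      proof (rule ccontr)
        assume "\<not> H \<subseteq> {l, r}"
        then obtain J where J: "J \<in> H" "J \<noteq> l" "J \<noteq> r" by blast
        have "{fst J..snd J} \<subseteq> {fst l..snd l} \<union> {fst r..snd r}"
          using l(2)[OF J(1)] r(2)[OF J(1)] l(1) r(1) by (auto simp: H_def)
        moreover have "l \<in> G - {J}" "r \<in> G - {J}" using l r J by (auto simp: H_def)
        ultimately have "{fst J..snd J} \<subseteq> U (G - {J})"
          unfolding U_def by (auto simp: case_prod_beta)
        moreover have "U G = U (G - {J}) \<union> {fst J..snd J}"
          using J(1) unfolding U_def H_def by (auto simp: case_prod_beta)
        ultimately have "U (G - {J}) = U F" using G by auto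
        then have "card G \<le> card (G - {J})" using G by (intro min) auto
        moreover have "card (G - {J}) < card G"
          using J(1) finG by (intro card_Diff1_less) (auto simp: H_def)
        ultimately show False by simp
      qed
      then have "card H \<le> card {l, r}" by (intro card_mono) auto
      also have "\<dots> \<le> 2" by (simp add: card_insert_if)
      finally show ?thesis by (simp add: H_def)
    qed (use H_def in \<open>metis card.empty zero_le\<close>)
  qed
  have "ennreal (\<Sum>(u,v)\<in>G. v - u) = (\<Sum>J\<in>G. emeasure lborel {fst J..snd J})"
  proof -
    have "(\<Sum>(u,v)\<in>G. v - u) = (\<Sum>J\<in>G. snd J - fst J)" by (simp add: case_prod_beta)
    moreover have "ennreal (\<Sum>J\<in>G. snd J - fst J) = (\<Sum>J\<in>G. ennreal (snd J - fst J))"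
      using G F by (intro sum_ennreal[symmetric]) force
    moreover have "(\<Sum>J\<in>G. ennreal (snd J - fst J)) = (\<Sum>J\<in>G. emeasure lborel {fst J..snd J})"
      using G F by (intro sum.cong) force+
    ultimately show ?thesis by simp
  qed
  also have "\<dots> = (\<integral>\<^sup>+ x. (\<Sum>J\<in>G. indicator {fst J..snd J} x) \<partial>lborel)"
    by (subst nn_integral_sum) auto
  also have "\<dots> \<le> (\<integral>\<^sup>+ x. 2 * indicator {a..b} x \<partial>lborel)"
  proof (rule nn_integral_mono)
    fix x :: real
    have eq: "(\<Sum>J\<in>G. indicator {fst J..snd J} x :: ennreal) = of_nat (card {J\<in>G. x \<in> {fst J..snd J}})"
      using finG by (simp add: indicator_def sum.If_cases Int_def conj_commute flip: of_bool_def)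
    show "(\<Sum>J\<in>G. indicator {fst J..snd J} x :: ennreal) \<le> 2 * indicator {a..b} x"
    proof (cases "x \<in> {a..b}")
      case True
      then show ?thesis unfolding eq using overlap[of x] by (simp add: of_nat_mono[of _ 2, simplified])
    next
      case False
      then have "{J\<in>G. x \<in> {fst J..snd J}} = {}" using G F by force
      then show ?thesis unfolding eq by (metis card.empty of_nat_0 zero_le)
    qed
  qed
  also have "\<dots> = ennreal 2 * ennreal (b - a)"
    using ab by (simp add: nn_integral_cmult)
  also have "\<dots> = ennreal (2 * (b - a))"
    using ab by (intro ennreal_mult[symmetric]) auto
  finally have "(\<Sum>(u,v)\<in>G. v - u) \<le> 2 * (b - a)" using ab by (simp add: ennreal_le_iff)
  then show ?thesis using that G unfolding U_def by blast
qed

text \<open>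
  Intermediate value theorem, with the first point at which the value 1 is taken.
\<close>

lemma first_hit_right:
  fixes f :: "real \<Rightarrow> real"
  assumes cont: "continuous_on UNIV f" and x: "f x < 1" and y: "x \<le> y" "1 \<le> f y"
  obtains v where "x < v" "v \<le> y" "f v = 1" "\<And>t. x \<le> t \<Longrightarrow> t \<le> v \<Longrightarrow> f t \<le> 1"
proof -
  define A where "A = {t\<in>{x..y}. f t = 1}"
  have cont': "continuous_on {s..t} f" for s t using cont continuous_on_subset by blast
  have hit: "\<exists>t\<in>A. t \<le> s" if "s \<in> {x..y}" "1 \<le> f s" for s
    using IVT'[of f x 1 s] that x cont' by (force simp: A_def)
  have ne: "A \<noteq> {}" using hit[of y] y by auto
  have "closed A"
    using continuous_closed_preimage_constant[OF cont'[of x y], of 1] by (simp add: A_def)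
  moreover have "bounded A"
    by (rule bounded_subset[OF bounded_closed_interval[of x y]]) (auto simp: A_def)
  ultimately have "compact A" by (simp add: compact_eq_bounded_closed)
  then obtain v where v: "v \<in> A" "\<And>t. t \<in> A \<Longrightarrow> v \<le> t"
    using compact_attains_inf[OF _ ne] by blast
  have "f t \<le> 1" if "x \<le> t" "t \<le> v" for t
  proof (rule ccontr)
    assume n: "\<not> f t \<le> 1"
    have "t \<in> {x..y}" using that v(1) by (auto simp: A_def)
    then obtain s where "s \<in> A" "s \<le> t" using hit[of t] n by force
    then have "t = v" using v(2) that by fastforce
    then show False using n v(1) by (simp add: A_def)
  qed
  moreover have "x < v" "v \<le> y" "f v = 1" using v(1) x by (auto simp: A_def less_le)
  ultimately show ?thesis using that by blast
qed

lemma first_hit_left: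
  fixes f :: "real \<Rightarrow> real"
  assumes cont: "continuous_on UNIV f" and x: "f x < 1" and y: "y \<le> x" "1 \<le> f y"
  obtains u where "y \<le> u" "u < x" "f u = 1" "\<And>t. u \<le> t \<Longrightarrow> t \<le> x \<Longrightarrow> f t \<le> 1"
proof -
  have "continuous_on UNIV (\<lambda>t. f (- t))"
    by (intro continuous_on_compose2[OF cont] continuous_intros) auto
  then obtain v where v: "- x < v" "v \<le> - y" "f (- v) = 1"
      "\<And>t. - x \<le> t \<Longrightarrow> t \<le> v \<Longrightarrow> f (- t) \<le> 1"
    using first_hit_right[of "\<lambda>t. f (- t)" "- x" "- y"] x y by auto
  show ?thesis
  proof (rule that[of "- v"])
    show "f t \<le> 1" if "- v \<le> t" "t \<le> x" for t using v(4)[of "- t"] that by auto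
  qed (use v in auto)
qed

text \<open>
  Take the intervals that are maximal among those on which at least one of the polynomials is at
  most 1. Maximality is what makes the induction on flags possible: if some \<open>p s\<close> stayed below 1 on
  such an interval, the interval could be enlarged up to the next point where \<open>p s\<close> takes the value
  1, which exists because \<open>p s\<close> reaches 1 somewhere in \<open>[c, d]\<close>. Therefore every \<open>p s\<close> reaches 1 on
  each of the intervals, which is the hypothesis that was assumed for \<open>[c, d]\<close>.
\<close>

lemma maximal_interval_cover:
  fixes p :: "'s \<Rightarrow> real poly"
  assumes fin: "finite S" and cd: "c \<le> d"
    and sup: "\<And>s. s \<in> S \<Longrightarrow> \<exists>y\<in>{c..d}. 1 \<le> poly (p s) y"
  obtains G where "finite G"
    "\<And>u v. (u, v) \<in> G \<Longrightarrow> c \<le> u \<and> u \<le> v \<and> v \<le> d"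
    "\<And>u v. (u, v) \<in> G \<Longrightarrow> \<exists>s\<in>S. \<forall>x\<in>{u..v}. poly (p s) x \<le> 1"
    "\<And>u v s. (u, v) \<in> G \<Longrightarrow> s \<in> S \<Longrightarrow> \<exists>y\<in>{u..v}. 1 \<le> poly (p s) y"
    "{x\<in>{c..d}. \<exists>s\<in>S. poly (p s) x < 1} \<subseteq> (\<Union>(u,v)\<in>G. {u..v})"
    "(\<Sum>(u,v)\<in>G. v - u) \<le> 2 * (d - c)"
proof -
  \<comment> \<open>All endpoints come from the finite set \<open>Z\<close>, which makes the family of candidate intervals finite
    and so provides maximal ones.\<close>
  define Z where "Z = {c, d} \<union> (\<Union>s\<in>{s\<in>S. p s \<noteq> 1}. {x. poly (p s - 1) x = 0})"
  have "finite {x. poly (p s - 1) x = 0}" if "p s \<noteq> 1" for s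
    using that by (intro poly_roots_finite) simp
  then have "finite (\<Union>s\<in>{s\<in>S. p s \<noteq> 1}. {x. poly (p s - 1) x = 0})"
    using fin by (intro finite_UN_I) auto
  then have finZ: "finite Z" by (simp add: Z_def)
  have cont: "continuous_on UNIV (poly (p s))" for s by (intro continuous_intros)
  have ZI: "x \<in> Z" if "s \<in> S" "poly (p s) x = 1" "poly (p s) x' < 1" for s x x'
    using that by (auto simp: Z_def intro!: bexI[of _ s])
  define J where "J = {(u, v). u \<in> Z \<and> v \<in> Z \<and> c \<le> u \<and> u \<le> v \<and> v \<le> d \<and>
      (\<exists>s\<in>S. \<forall>x\<in>{u..v}. poly (p s) x \<le> 1)}"
  have finJ: "finite J" by (rule finite_subset[of _ "Z \<times> Z"]) (use finZ J_def in auto)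
  define F where "F = {(u, v)\<in>J. \<forall>(u', v')\<in>J. u' \<le> u \<longrightarrow> v \<le> v' \<longrightarrow> u' = u \<and> v' = v}"
  have "F \<subseteq> J" by (auto simp: F_def)
  then have finF: "finite F" using finJ finite_subset by blast
  have F_above: "\<exists>(u', v')\<in>F. u' \<le> u \<and> v \<le> v'" if uv: "(u, v) \<in> J" for u v
  proof -
    define A where "A = {(u', v')\<in>J. u' \<le> u \<and> v \<le> v'}"
    have "finite A" "A \<noteq> {}" using finJ uv by (auto simp: A_def intro: finite_subset[of _ J])
    then obtain w where w: "w \<in> A" "\<And>w'. w' \<in> A \<Longrightarrow> snd w' - fst w' \<le> snd w - fst w"
      using Max_in[of "(\<lambda>w. snd w - fst w) ` A"] Max_ge[of "(\<lambda>w. snd w - fst w) ` A"] by fastforce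
    have "w \<in> F"
    proof -
      have "u' = fst w \<and> v' = snd w" if "(u', v') \<in> J" "u' \<le> fst w" "snd w \<le> v'" for u' v'
      proof -
        have "(u', v') \<in> A" using that w(1) by (auto simp: A_def)
        from w(2)[OF this] show ?thesis using that by auto
      qed
      then show ?thesis using w(1) by (auto simp: F_def A_def)
    qed
    then show ?thesis using w(1) by (auto simp: A_def intro!: bexI[of _ w])
  qed
  have cover: "\<exists>(u, v)\<in>F. x \<in> {u..v}" if x: "x \<in> {c..d}" and s: "s \<in> S" "poly (p s) x < 1" for x s
  proof -
    have "\<exists>v\<in>Z. x \<le> v \<and> v \<le> d \<and> (\<forall>t. x \<le> t \<longrightarrow> t \<le> v \<longrightarrow> poly (p s) t \<le> 1)"
    proof (cases "\<exists>y. x \<le> y \<and> y \<le> d \<and> 1 \<le> poly (p s) y")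
      case True
      then obtain y where y: "x \<le> y" "y \<le> d" "1 \<le> poly (p s) y" by blast
      obtain v where "x < v" "v \<le> y" "poly (p s) v = 1" "\<And>t. x \<le> t \<Longrightarrow> t \<le> v \<Longrightarrow> poly (p s) t \<le> 1"
        using first_hit_right[OF cont s(2) y(1,3)] by blast
      then show ?thesis using y ZI[OF s(1) _ s(2)] by (intro bexI[of _ v]) auto
    next
      case False
      then show ?thesis using x by (intro bexI[of _ d]) (force simp: Z_def)+
    qed
    then obtain v where v: "v \<in> Z" "x \<le> v" "v \<le> d" "\<And>t. x \<le> t \<Longrightarrow> t \<le> v \<Longrightarrow> poly (p s) t \<le> 1" by blast
    have "\<exists>u\<in>Z. c \<le> u \<and> u \<le> x \<and> (\<forall>t. u \<le> t \<longrightarrow> t \<le> x \<longrightarrow> poly (p s) t \<le> 1)"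
    proof (cases "\<exists>y. c \<le> y \<and> y \<le> x \<and> 1 \<le> poly (p s) y")
      case True
      then obtain y where y: "c \<le> y" "y \<le> x" "1 \<le> poly (p s) y" by blast
      obtain u where "y \<le> u" "u < x" "poly (p s) u = 1" "\<And>t. u \<le> t \<Longrightarrow> t \<le> x \<Longrightarrow> poly (p s) t \<le> 1"
        using first_hit_left[OF cont s(2) y(2,3)] by blast
      then show ?thesis using y ZI[OF s(1) _ s(2)] by (intro bexI[of _ u]) auto
    next
      case False
      then show ?thesis using x by (intro bexI[of _ c]) (force simp: Z_def)+
    qed
    then obtain u where u: "u \<in> Z" "c \<le> u" "u \<le> x" "\<And>t. u \<le> t \<Longrightarrow> t \<le> x \<Longrightarrow> poly (p s) t \<le> 1" by blast
    have "\<forall>t\<in>{u..v}. poly (p s) t \<le> 1"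
      using u(4) v(4) by (metis atLeastAtMost_iff linear)
    then have "(u, v) \<in> J" using u v s(1) by (auto simp: J_def)
    then obtain u' v' where "(u', v') \<in> F" "u' \<le> u" "v \<le> v'" using F_above[of u v] by blast
    then show ?thesis using u(3) v(2) by (intro bexI[of _ "(u', v')"]) auto
  qed
  have reach: "\<exists>y\<in>{u..v}. 1 \<le> poly (p s) y" if uv: "(u, v) \<in> F" and s: "s \<in> S" for u v s
  proof (rule ccontr)
    assume "\<not> ?thesis"
    then have small: "poly (p s) t < 1" if "u \<le> t" "t \<le> v" for t using that by force
    have uvJ: "(u, v) \<in> J"
      and max: "\<And>u' v'. (u', v') \<in> J \<Longrightarrow> u' \<le> u \<Longrightarrow> v \<le> v' \<Longrightarrow> u' = u \<and> v' = v"
      using uv by (auto simp: F_def)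
    have b: "u \<in> Z" "v \<in> Z" "c \<le> u" "u \<le> v" "v \<le> d" using uvJ by (auto simp: J_def)
    obtain y where y: "y \<in> {c..d}" "1 \<le> poly (p s) y" using sup[OF s] by blast
    then consider "v \<le> y" | "y \<le> u" using small[of y] by fastforce
    then show False
    proof cases
      case 1
      obtain w where w: "v < w" "w \<le> y" "poly (p s) w = 1" "\<And>t. v \<le> t \<Longrightarrow> t \<le> w \<Longrightarrow> poly (p s) t \<le> 1"
        using first_hit_right[OF cont small[of v] 1 y(2)] b by auto
      have "\<forall>t\<in>{u..w}. poly (p s) t \<le> 1" using w(4) small by (metis atLeastAtMost_iff linear less_imp_le)
      then have "(u, w) \<in> J" using w b y s ZI[OF s w(3) small[of v]] by (auto simp: J_def)
      then show False using max[of u w] w(1) by auto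
    next
      case 2
      obtain w where w: "y \<le> w" "w < u" "poly (p s) w = 1" "\<And>t. w \<le> t \<Longrightarrow> t \<le> u \<Longrightarrow> poly (p s) t \<le> 1"
        using first_hit_left[OF cont small[of u] 2 y(2)] b by auto
      have "\<forall>t\<in>{w..v}. poly (p s) t \<le> 1" using w(4) small by (metis atLeastAtMost_iff linear less_imp_le)
      then have "(w, v) \<in> J" using w b y s ZI[OF s w(3) small[of u]] by (auto simp: J_def)
      then show False using max[of w v] w(2) by auto
    qed
  qed
  obtain G where G: "G \<subseteq> F" "(\<Union>(u,v)\<in>G. {u..v}) = (\<Union>(u,v)\<in>F. {u..v})"
    "(\<Sum>(u,v)\<in>G. v - u) \<le> 2 * (d - c)"
    using interval_subcover_length[OF cd finF] by (auto simp: F_def J_def)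
  show ?thesis
  proof (rule that[of G])
    show "finite G" using G(1) finF finite_subset by blast
    show "{x\<in>{c..d}. \<exists>s\<in>S. poly (p s) x < 1} \<subseteq> (\<Union>(u,v)\<in>G. {u..v})"
      unfolding G(2) using cover by fastforce
    show "\<exists>y\<in>{u..v}. 1 \<le> poly (p s) y" if "(u, v) \<in> G" "s \<in> S" for u v s
      using reach G(1) that by blast
  qed (use G in \<open>auto simp: F_def J_def\<close>)
qed

section \<open>Points marked by a flag\<close>

text \<open>
  The elements of \<open>S\<close> play the role of subspaces, with \<open>inc\<close> as the comparability relation, so that
  \<open>T\<close> is a flag.
\<close>

definition marked :: "('s \<Rightarrow> 's \<Rightarrow> bool) \<Rightarrow> ('s \<Rightarrow> real poly) \<Rightarrow> real \<Rightarrow> 's set \<Rightarrow> real \<Rightarrow> bool" where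
  "marked inc p \<epsilon> S x \<longleftrightarrow> (\<exists>T\<subseteq>S. (\<forall>s\<in>T. \<forall>t\<in>T. inc s t) \<and>
     (\<forall>t\<in>T. \<epsilon> \<le> poly (p t) x \<and> poly (p t) x \<le> 1) \<and>
     (\<forall>s\<in>S - T. (\<forall>t\<in>T. inc s t) \<longrightarrow> 1 \<le> poly (p s) x))"

text \<open>
  The function \<open>r\<close> generalises the dimension: it separates comparable elements, so a flag has at most
  \<open>L\<close> members, and the induction is on \<open>L\<close>.
  
  On each maximal interval choose \<open>s\<close> with \<open>p s \<le> 1\<close> there, and apply the induction hypothesis to the
  other elements comparable with \<open>s\<close>, whose ranks avoid \<open>r s\<close>. A flag obtained in this way can be
  extended by \<open>s\<close>, except where \<open>p s\<close> falls below \<open>\<delta> ^ D\<close>. The factor \<open>2 ^ L\<close> comes from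
  the overlap of the intervals, once for each step.
\<close>

lemma unmarked_measure:
  fixes p :: "'s \<Rightarrow> real poly" and r :: "'s \<Rightarrow> 'r"
  assumes \<delta>: "0 < \<delta>" "\<delta> \<le> 1/2"
    and deg: "\<And>s. s \<in> S \<Longrightarrow> degree (p s) \<le> D"
    and nonneg: "\<And>s x. s \<in> S \<Longrightarrow> 0 \<le> poly (p s) x"
    and inc_refl: "\<And>s. inc s s" and inc_sym: "\<And>s t. inc s t \<Longrightarrow> inc t s"
    and rank: "\<And>s t. s \<in> S \<Longrightarrow> t \<in> S \<Longrightarrow> inc s t \<Longrightarrow> s \<noteq> t \<Longrightarrow> r s \<noteq> r t"
    and fin: "finite S" and card: "card (r ` S) \<le> L" and cd: "c \<le> d"
    and sup: "\<And>s. s \<in> S \<Longrightarrow> \<exists>y\<in>{c..d}. 1 \<le> poly (p s) y"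
  shows "\<exists>E\<in>sets lborel. {x\<in>{c..d}. \<not> marked inc p (\<delta> ^ D) S x} \<subseteq> E \<and>
     emeasure lborel E \<le> ennreal (8 * real D * real L * 2 ^ L * \<delta> * (d - c))"
  using deg nonneg rank fin card cd sup
proof (induction L arbitrary: S c d)
  case 0
  then have "S = {}" by auto
  then have "{x\<in>{c..d}. \<not> marked inc p (\<delta> ^ D) S x} = {}" by (auto simp: marked_def)
  then show ?case by (intro bexI[of _ "{}"]) auto
next
  case (Suc L)
  obtain G where finG: "finite G"
    and G_le: "\<And>u v. (u, v) \<in> G \<Longrightarrow> c \<le> u \<and> u \<le> v \<and> v \<le> d"
    and G_small: "\<And>u v. (u, v) \<in> G \<Longrightarrow> \<exists>s\<in>S. \<forall>x\<in>{u..v}. poly (p s) x \<le> 1"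
    and G_sup: "\<And>u v s. (u, v) \<in> G \<Longrightarrow> s \<in> S \<Longrightarrow> \<exists>y\<in>{u..v}. 1 \<le> poly (p s) y"
    and G_cover: "{x\<in>{c..d}. \<exists>s\<in>S. poly (p s) x < 1} \<subseteq> (\<Union>(u,v)\<in>G. {u..v})"
    and G_len: "(\<Sum>(u,v)\<in>G. v - u) \<le> 2 * (d - c)"
    using maximal_interval_cover[OF Suc.prems(4,6), of p] Suc.prems(7) by blast
  define K where "K = 4 * real D * \<delta> + 8 * real D * real L * 2 ^ L * \<delta>"
  have K0: "0 \<le> K" using \<delta> by (simp add: K_def)
  have local: "\<exists>E\<in>sets lborel. {x\<in>{u..v}. \<not> marked inc p (\<delta> ^ D) S x} \<subseteq> E \<and>
      emeasure lborel E \<le> ennreal (K * (v - u))" if uv: "(u, v) \<in> G" for u v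
  proof -
    obtain s where s: "s \<in> S" "\<forall>x\<in>{u..v}. poly (p s) x \<le> 1" using G_small[OF uv] by blast
    define S0 where "S0 = {t\<in>S. inc t s \<and> t \<noteq> s}"
    have S0: "S0 \<subseteq> S" by (auto simp: S0_def)
    have "r ` S0 \<subseteq> r ` S - {r s}" using Suc.prems(3) s(1) by (auto simp: S0_def)
    then have "card (r ` S0) \<le> card (r ` S - {r s})"
      using Suc.prems(4) by (intro card_mono) auto
    also have "\<dots> \<le> L" using Suc.prems(4,5) s(1) by (subst card_Diff_singleton) auto
    finally have cardS0: "card (r ` S0) \<le> L" .
    have "\<exists>E\<in>sets lborel. {x\<in>{u..v}. \<not> marked inc p (\<delta> ^ D) S0 x} \<subseteq> E \<and>
       emeasure lborel E \<le> ennreal (8 * real D * real L * 2 ^ L * \<delta> * (v - u))"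
    proof (rule Suc.IH)
      show "finite S0" using S0 Suc.prems(4) finite_subset by blast
      show "r s \<noteq> r t" if "s \<in> S0" "t \<in> S0" "inc s t" "s \<noteq> t" for s t
        using Suc.prems(3) S0 that by blast
    qed (use S0 Suc.prems(1,2) cardS0 G_le[OF uv] G_sup[OF uv] in auto)
    then obtain E where E: "E \<in> sets lborel" "{x\<in>{u..v}. \<not> marked inc p (\<delta> ^ D) S0 x} \<subseteq> E"
       "emeasure lborel E \<le> ennreal (8 * real D * real L * 2 ^ L * \<delta> * (v - u))" by blast
    define N where "N = {x\<in>{u..v}. \<bar>poly (p s) x\<bar> < \<delta> ^ D}"
    have "open ((\<lambda>x. \<bar>poly (p s) x\<bar>) -` {..<\<delta> ^ D})" by (intro open_vimage continuous_intros)
    moreover have "N = {u..v} \<inter> (\<lambda>x. \<bar>poly (p s) x\<bar>) -` {..<\<delta> ^ D}" by (auto simp: N_def)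
    ultimately have N: "N \<in> sets lborel" by auto
    obtain y where y: "y \<in> {u..v}" "1 \<le> poly (p s) y" using G_sup[OF uv s(1)] by blast
    have N_le: "emeasure lborel N \<le> ennreal (4 * real D * \<delta> * (v - u))"
      unfolding N_def by (rule poly_sublevel_measure[OF Suc.prems(1)[OF s(1)] y(1) _ \<delta>]) (use y in auto)
    have "{x\<in>{u..v}. \<not> marked inc p (\<delta> ^ D) S x} \<subseteq> E \<union> N"
    proof (rule ccontr)
      assume "\<not> ?thesis"
      then obtain x where x: "x \<in> {u..v}" "\<not> marked inc p (\<delta> ^ D) S x" "x \<notin> E" "x \<notin> N" by auto
      then have "marked inc p (\<delta> ^ D) S0 x" using E(2) by auto
      then obtain T where T: "T \<subseteq> S0" "\<forall>s\<in>T. \<forall>t\<in>T. inc s t"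
        "\<forall>t\<in>T. \<delta> ^ D \<le> poly (p t) x \<and> poly (p t) x \<le> 1"
        "\<forall>s\<in>S0 - T. (\<forall>t\<in>T. inc s t) \<longrightarrow> 1 \<le> poly (p s) x"
        unfolding marked_def by blast
      have "\<delta> ^ D \<le> poly (p s) x" using x(1,4) Suc.prems(2)[OF s(1), of x] by (auto simp: N_def)
      moreover have "poly (p s) x \<le> 1" using s(2) x(1) by auto
      ultimately have "marked inc p (\<delta> ^ D) S x"
        unfolding marked_def using T S0 s(1) inc_refl inc_sym
        by (intro exI[of _ "insert s T"]) (auto simp: S0_def)
      then show False using x(2) by simp
    qed
    moreover have "emeasure lborel (E \<union> N) \<le> ennreal (K * (v - u))"
    proof -
      have "emeasure lborel (E \<union> N) \<le> emeasure lborel E + emeasure lborel N"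
        using E(1) N by (rule emeasure_subadditive)
      also have "\<dots> \<le> ennreal (8 * real D * real L * 2 ^ L * \<delta> * (v - u)) + ennreal (4 * real D * \<delta> * (v - u))"
        using E(3) N_le by (rule add_mono)
      also have "\<dots> = ennreal (K * (v - u))"
        using \<delta> G_le[OF uv] by (subst ennreal_plus[symmetric]) (auto simp: K_def distrib_right)
      finally show ?thesis .
    qed
    ultimately show ?thesis using E(1) N by (intro bexI[of _ "E \<union> N"]) auto
  qed
  have "\<exists>E. E \<in> sets lborel \<and>
      {x\<in>{fst J..snd J}. \<not> marked inc p (\<delta> ^ D) S x} \<subseteq> E \<and>
      emeasure lborel E \<le> ennreal (K * (snd J - fst J))" if "J \<in> G" for J
    using local[of "fst J" "snd J"] that by auto
  then obtain E where E: "\<And>J. J \<in> G \<Longrightarrow> E J \<in> sets lborel \<and>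
      {x\<in>{fst J..snd J}. \<not> marked inc p (\<delta> ^ D) S x} \<subseteq> E J \<and>
      emeasure lborel (E J) \<le> ennreal (K * (snd J - fst J))"
    by metis
  have "{x\<in>{c..d}. \<not> marked inc p (\<delta> ^ D) S x} \<subseteq> (\<Union>J\<in>G. E J)"
  proof
    fix x assume x: "x \<in> {x\<in>{c..d}. \<not> marked inc p (\<delta> ^ D) S x}"
    have "\<exists>s\<in>S. poly (p s) x < 1"
    proof (rule ccontr)
      assume "\<not> ?thesis"
      then have "marked inc p (\<delta> ^ D) S x" unfolding marked_def by (intro exI[of _ "{}"]) auto
      then show False using x by simp
    qed
    then have "x \<in> (\<Union>(u,v)\<in>G. {u..v})" using G_cover x by blast
    then obtain J where "J \<in> G" "x \<in> {fst J..snd J}" by (auto simp: case_prod_beta)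
    then show "x \<in> (\<Union>J\<in>G. E J)" using E x by blast
  qed
  moreover have "emeasure lborel (\<Union>J\<in>G. E J) \<le> ennreal (8 * real D * real (Suc L) * 2 ^ Suc L * \<delta> * (d - c))"
  proof -
    have "emeasure lborel (\<Union>J\<in>G. E J) \<le> (\<Sum>J\<in>G. emeasure lborel (E J))"
      using E finG by (intro emeasure_subadditive_finite) auto
    also have "\<dots> \<le> (\<Sum>J\<in>G. ennreal (K * (snd J - fst J)))" using E by (intro sum_mono) auto
    also have "\<dots> = ennreal (\<Sum>J\<in>G. K * (snd J - fst J))"
      using G_le K0 by (intro sum_ennreal) force
    also have "(\<Sum>J\<in>G. K * (snd J - fst J)) = K * (\<Sum>(u,v)\<in>G. v - u)"
      by (simp add: sum_distrib_left case_prod_beta)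
    also have "ennreal \<dots> \<le> ennreal (8 * real D * real (Suc L) * 2 ^ Suc L * \<delta> * (d - c))"
    proof (rule ennreal_leI)
      have "K * (\<Sum>(u,v)\<in>G. v - u) \<le> K * (2 * (d - c))" using G_len K0 by (intro mult_left_mono)
      also have "\<dots> = (8 * real D * \<delta> + 8 * real D * real L * 2 ^ Suc L * \<delta>) * (d - c)" by (simp add: K_def algebra_simps)
      also have "\<dots> \<le> (8 * real D * \<delta> * 2 ^ Suc L + 8 * real D * real L * 2 ^ Suc L * \<delta>) * (d - c)"
      proof -
        have "8 * real D * \<delta> * 1 \<le> 8 * real D * \<delta> * 2 ^ Suc L"
          using \<delta> one_le_power[of "2::real" "Suc L"] by (intro mult_left_mono) auto
        then show ?thesis using Suc.prems(6) by (intro mult_right_mono) auto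
      qed
      also have "\<dots> = 8 * real D * real (Suc L) * 2 ^ Suc L * \<delta> * (d - c)" by (simp add: algebra_simps)
      finally show "K * (\<Sum>(u,v)\<in>G. v - u) \<le> 8 * real D * real (Suc L) * 2 ^ Suc L * \<delta> * (d - c)" .
    qed
    finally show ?thesis .
  qed
  moreover have "(\<Union>J\<in>G. E J) \<in> sets lborel" using E finG by (intro sets.finite_UN) auto
  ultimately show ?case by blast
qed

section \<open>Wronskians and minors of derivatives\<close>

interpretation rp: vector_space "smult :: real \<Rightarrow> real poly \<Rightarrow> real poly"
  by unfold_locales (auto simp: smult_add_left smult_add_right)

lemma higher_pderiv_sum_smult:
  fixes P :: "'a \<Rightarrow> real poly"
  shows "(pderiv ^^ b) (\<Sum>a\<in>A. smult (y a) (P a)) = (\<Sum>a\<in>A. smult (y a) ((pderiv ^^ b) (P a)))"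
  by (simp add: higher_pderiv_sum higher_pderiv_smult)

lemma order_higher_pderiv:
  fixes p :: "real poly"
  assumes "p \<noteq> 0" "j \<le> order a p"
  shows "(pderiv ^^ j) p \<noteq> 0 \<and> order a ((pderiv ^^ j) p) = order a p - j"
  using assms(2)
proof (induction j)
  case (Suc j)
  then have IH: "(pderiv ^^ j) p \<noteq> 0" "order a ((pderiv ^^ j) p) = order a p - j" by auto
  then have o: "order a ((pderiv ^^ j) p) \<noteq> 0" using Suc.prems by auto
  have "pderiv ((pderiv ^^ j) p) \<noteq> 0"
  proof
    assume "pderiv ((pderiv ^^ j) p) = 0"
    then obtain h where "(pderiv ^^ j) p = [:h:]" using pderiv_iszero by blast
    then show False using IH(1) o by (auto simp: order_0I)
  qed
  then show ?case using order_pderiv[OF IH(1), of a] o IH(2) by (auto simp: order_root)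
qed (use assms in auto)

text \<open>
  Uniqueness for a linear differential equation of order \<open>r\<close> at a point where the leading coefficient
  does not vanish. Let \<open>m > r\<close> be the order of vanishing of \<open>P\<close>. Then the leading term has order exactly
  \<open>m - r\<close>, and all the other terms have larger order, so they cannot cancel it.
\<close>

lemma ode_solution_vanishing_eq_0:
  fixes P :: "real poly"
  assumes ode: "(\<Sum>b\<le>r. c b * (pderiv ^^ b) P) = 0" and c: "poly (c r) x0 \<noteq> 0"
    and van: "\<And>b. b \<le> r \<Longrightarrow> poly ((pderiv ^^ b) P) x0 = 0"
  shows "P = 0"
proof (rule ccontr)
  assume P: "P \<noteq> 0"
  define m where "m = order x0 P"
  have mr: "r < m"
  proof (rule ccontr)
    assume "\<not> r < m"
    then have "order x0 ((pderiv ^^ m) P) = 0" "(pderiv ^^ m) P \<noteq> 0"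
      using order_higher_pderiv[OF P, of m x0] by (auto simp: m_def)
    moreover have "poly ((pderiv ^^ m) P) x0 = 0" using van \<open>\<not> r < m\<close> by auto
    ultimately show False by (simp add: order_root)
  qed
  define X where "X = [:- x0, 1:]"
  define S where "S = (\<Sum>b<r. c b * (pderiv ^^ b) P)"
  have "X ^ (m - r + 1) dvd c b * (pderiv ^^ b) P" if b: "b < r" for b
  proof -
    have "order x0 ((pderiv ^^ b) P) = m - b"
      using order_higher_pderiv[OF P, of b x0] b mr by (simp add: m_def)
    then have "X ^ (m - b) dvd (pderiv ^^ b) P"
      using order_1[of x0 "(pderiv ^^ b) P"] by (simp add: X_def)
    moreover have "X ^ (m - r + 1) dvd X ^ (m - b)" using b mr by (intro le_imp_power_dvd) auto
    ultimately show ?thesis by (meson dvd_mult dvd_trans)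
  qed
  then have "X ^ (m - r + 1) dvd S" unfolding S_def by (intro dvd_sum) auto
  moreover have "c r * (pderiv ^^ r) P = - S"
    using ode by (simp add: S_def lessThan_Suc_atMost[symmetric] eq_neg_iff_add_eq_0 add.commute)
  ultimately have dvd: "X ^ (m - r + 1) dvd c r * (pderiv ^^ r) P" by simp
  have nz: "c r * (pderiv ^^ r) P \<noteq> 0"
    using c order_higher_pderiv[OF P, of r x0] mr by (auto simp: m_def)
  have "order x0 (c r * (pderiv ^^ r) P) = m - r"
    using order_mult[OF nz, of x0] c order_higher_pderiv[OF P, of r x0] mr by (simp add: order_0I m_def)
  then show False using dvd nz unfolding X_def by (simp only: order_divides) simp
qed

text \<open>
  The determinant of the derivatives whose orders are listed in \<open>is\<close>. Repeated and unsorted lists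
  are allowed; the Wronskian is the case \<open>[0..<k]\<close>.
\<close>

definition minor :: "real poly list \<Rightarrow> nat list \<Rightarrow> real poly" where
  "minor Ps is = Determinant.det (mat (length Ps) (length Ps) (\<lambda>(a, b). (pderiv ^^ (is ! b)) (Ps ! a)))"

lemma independent_nth_coeffs_eq_0:
  assumes ind: "rp.independent (set Ps)" and dist: "distinct Ps"
    and eq: "(\<Sum>a<length Ps. smult (y a) (Ps ! a)) = 0" and a: "a < length Ps"
  shows "y a = 0"
proof -
  have bij: "bij_betw (nth Ps) {..<length Ps} (set Ps)" using dist by (simp add: bij_betw_nth)
  define u where "u = (\<lambda>v. y (inv_into {..<length Ps} (nth Ps) v))"
  have u: "u (Ps ! a) = y a" if "a < length Ps" for a
    unfolding u_def using bij that by (simp add: bij_betw_def)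
  have "(\<Sum>v\<in>set Ps. smult (u v) v) = (\<Sum>a<length Ps. smult (u (Ps ! a)) (Ps ! a))"
    by (rule sum.reindex_bij_betw[OF bij, symmetric])
  also have "\<dots> = 0" using eq u by simp
  finally have "u (Ps ! a) = 0"
    using ind a unfolding rp.independent_explicit_finite_subsets by (meson List.finite_set nth_mem subset_refl)
  then show ?thesis using u a by simp
qed

text \<open>
  If the Wronskian vanishes identically, then a linear dependence between its columns over the
  polynomial ring is a linear differential equation, of order \<open>r < k\<close>, solved by all the \<open>k\<close>
  polynomials. At a point where its leading coefficient does not vanish, the rows of the Wronskian
  matrix are dependent over the reals. This gives a nontrivial real combination of the polynomials with
  a zero of order at least \<open>k\<close>, which must be 0 by uniqueness for the equation.
\<close>

lemma wronskian_nonzero: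
  assumes ind: "rp.independent (set Ps)" and dist: "distinct Ps"
  shows "minor Ps [0..<length Ps] \<noteq> 0"
proof
  define k where "k = length Ps"
  define M where "M = mat k k (\<lambda>(a, b). (pderiv ^^ b) (Ps ! a))"
  have M: "M \<in> carrier_mat k k" by (simp add: M_def)
  assume "minor Ps [0..<length Ps] = 0"
  moreover have "minor Ps [0..<length Ps] = Determinant.det M"
    unfolding minor_def M_def k_def by (intro arg_cong[of _ _ Determinant.det] eq_matI) auto
  ultimately have det0: "Determinant.det M = 0" by simp
  then obtain v where v: "v \<in> carrier_vec k" "v \<noteq> 0\<^sub>v k" "M *\<^sub>v v = 0\<^sub>v k"
    using det_0_iff_vec_prod_zero[OF M] by blast
  have ode: "(\<Sum>b<k. v $ b * (pderiv ^^ b) (Ps ! a)) = 0" if a: "a < k" for a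
  proof -
    have "(M *\<^sub>v v) $ a = (\<Sum>b\<in>{0..<k}. (pderiv ^^ b) (Ps ! a) * v $ b)"
      using a v(1) by (simp add: M_def scalar_prod_def)
    then show ?thesis using v(3) a by (simp add: lessThan_atLeast0 mult.commute)
  qed
  define R where "R = {b. b < k \<and> v $ b \<noteq> 0}"
  have R: "finite R" "R \<noteq> {}" using v(1,2) by (auto simp: R_def)
  define r where "r = Max R"
  have r: "r < k" "v $ r \<noteq> 0" using Max_in[OF R] by (auto simp: r_def R_def)
  have above: "v $ b = 0" if "r < b" "b < k" for b
  proof (rule ccontr)
    assume "v $ b \<noteq> 0"
    then have "b \<in> R" using that by (simp add: R_def)
    then show False using Max_ge[OF R(1), of b] that by (simp add: r_def)
  qed
  obtain x0 where x0: "poly (v $ r) x0 \<noteq> 0" using r(2) poly_all_0_iff_0 by blast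
  interpret ev: comm_ring_hom "\<lambda>p :: real poly. poly p x0" by unfold_locales auto
  define Mx where "Mx = map_mat (\<lambda>p. poly p x0) M"
  have Mx: "Mx\<^sup>T \<in> carrier_mat k k" using M by (simp add: Mx_def)
  have "Determinant.det Mx\<^sup>T = 0"
    using det_transpose[of Mx k] M det0 by (simp add: Mx_def)
  then obtain y where y: "y \<in> carrier_vec k" "y \<noteq> 0\<^sub>v k" "Mx\<^sup>T *\<^sub>v y = 0\<^sub>v k"
    using det_0_iff_vec_prod_zero[OF Mx] by blast
  define P where "P = (\<Sum>a<k. smult (y $ a) (Ps ! a))"
  have "P = 0"
  proof (rule ode_solution_vanishing_eq_0[where c = "\<lambda>b. v $ b" and r = r and ?x0.0 = x0])
    fix b assume b: "b \<le> r"
    have "(Mx\<^sup>T *\<^sub>v y) $ b = (\<Sum>a\<in>{0..<k}. poly ((pderiv ^^ b) (Ps ! a)) x0 * y $ a)"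
      using b r(1) y(1) M by (simp add: Mx_def M_def scalar_prod_def)
    then show "poly ((pderiv ^^ b) P) x0 = 0"
      unfolding P_def higher_pderiv_sum_smult using y(3) b r(1)
      by (simp add: lessThan_atLeast0 mult.commute poly_sum)
  next
    have "(\<Sum>b\<le>r. v $ b * (pderiv ^^ b) P) = (\<Sum>b<k. v $ b * (pderiv ^^ b) P)"
      using r(1) above by (intro sum.mono_neutral_left) auto
    also have "\<dots> = (\<Sum>b<k. \<Sum>a<k. smult (y $ a) (v $ b * (pderiv ^^ b) (Ps ! a)))"
      unfolding P_def higher_pderiv_sum_smult by (simp add: sum_distrib_left)
    also have "\<dots> = (\<Sum>a<k. smult (y $ a) (\<Sum>b<k. v $ b * (pderiv ^^ b) (Ps ! a)))"
      by (subst sum.swap) (simp add: rp.scale_sum_right)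
    also have "\<dots> = 0" using ode by simp
    finally show "(\<Sum>b\<le>r. v $ b * (pderiv ^^ b) P) = 0" .
  qed (use x0 in simp)
  then have "y $ a = 0" if "a < k" for a
    using independent_nth_coeffs_eq_0[OF ind dist, of "\<lambda>a. y $ a"] that by (simp add: P_def k_def)
  then have "y = 0\<^sub>v k" using y(1) by (intro eq_vecI) auto
  then show False using y(2) by simp
qed

text \<open>
  The factor \<open>t\<close> is the determinant of the transition matrix. It is a real number that does not depend
  on the choice of the columns, which makes the covolumes of two bases of a subspace
  proportional as functions of the point.
\<close>

lemma minor_basis_change:
  assumes len: "length Ps = length Qs" and dist: "distinct Qs"
    and span: "set Ps \<subseteq> rp.span (set Qs)"
  obtains t where "\<And>is. minor Ps is = smult t (minor Qs is)"
proof -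
  define k where "k = length Qs"
  have bij: "bij_betw (nth Qs) {..<k} (set Qs)" using dist by (simp add: bij_betw_nth k_def)
  have "\<exists>f. Ps ! a = (\<Sum>c<k. smult (f c) (Qs ! c))" if "a < k" for a
  proof -
    have "Ps ! a \<in> rp.span (set Qs)" using span that len by (auto simp: k_def)
    then obtain u where "Ps ! a = (\<Sum>v\<in>set Qs. smult (u v) v)" by (auto simp: rp.span_finite)
    also have "\<dots> = (\<Sum>c<k. smult (u (Qs ! c)) (Qs ! c))"
      by (rule sum.reindex_bij_betw[OF bij, symmetric])
    finally show ?thesis by (rule exI[of _ "\<lambda>c. u (Qs ! c)"])
  qed
  then obtain f where f: "\<And>a. a < k \<Longrightarrow> Ps ! a = (\<Sum>c<k. smult (f a c) (Qs ! c))" by metis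
  define T where "T = mat k k (\<lambda>(a, c). f a c)"
  interpret const: comm_ring_hom "\<lambda>c :: real. [:c:]" by unfold_locales (auto simp: one_pCons)
  have "minor Ps is = smult (Determinant.det T) (minor Qs is)" for "is"
  proof -
    define B where "B = mat k k (\<lambda>(a, b). (pderiv ^^ (is ! b)) (Qs ! a))"
    have "mat k k (\<lambda>(a, b). (pderiv ^^ (is ! b)) (Ps ! a)) = map_mat (\<lambda>c. [:c:]) T * B"
      by (intro eq_matI) (auto simp: T_def B_def f higher_pderiv_sum_smult scalar_prod_def lessThan_atLeast0)
    then have "minor Ps is = Determinant.det (map_mat (\<lambda>c. [:c:]) T * B)"
      by (simp add: minor_def len k_def)
    also have "\<dots> = Determinant.det (map_mat (\<lambda>c. [:c:]) T) * Determinant.det B"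
      by (rule det_mult) (auto simp: T_def B_def)
    finally show ?thesis by (simp add: minor_def B_def k_def)
  qed
  then show ?thesis using that by blast
qed

lemma minor_Cons:
  assumes "length is = Suc (length Ps)"
  shows "minor (v # Ps) is =
    (\<Sum>j<length is. (-1) ^ j * (pderiv ^^ (is ! j)) v * minor Ps (take j is @ drop (Suc j) is))"
proof -
  define k where "k = length Ps"
  define A where "A = mat (Suc k) (Suc k) (\<lambda>(a, b). (pderiv ^^ (is ! b)) ((v # Ps) ! a))"
  have "minor (v # Ps) is = Determinant.det A" by (simp add: minor_def A_def k_def)
  also have "\<dots> = (\<Sum>j<Suc k. A $$ (0, j) * cofactor A 0 j)"
    by (rule laplace_expansion_row) (auto simp: A_def)
  also have "\<dots> = (\<Sum>j<Suc k. (-1) ^ j * (pderiv ^^ (is ! j)) v * minor Ps (take j is @ drop (Suc j) is))"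
  proof (rule sum.cong[OF refl])
    fix j assume j: "j \<in> {..<Suc k}"
    have "mat_delete A 0 j = mat k k (\<lambda>(a, b). (pderiv ^^ ((take j is @ drop (Suc j) is) ! b)) (Ps ! a))"
      unfolding mat_delete_def
      by (rule eq_matI) (use j assms in \<open>auto simp: A_def k_def nth_append min_def\<close>)
    then have "cofactor A 0 j = (-1) ^ j * minor Ps (take j is @ drop (Suc j) is)"
      by (simp add: cofactor_def minor_def k_def)
    moreover have "A $$ (0, j) = (pderiv ^^ (is ! j)) v" using j by (simp add: A_def)
    ultimately show "A $$ (0, j) * cofactor A 0 j =
        (-1) ^ j * (pderiv ^^ (is ! j)) v * minor Ps (take j is @ drop (Suc j) is)"
      by (simp add: mult_ac)
  qed
  finally show ?thesis using assms by (simp add: k_def)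
qed

lemma degree_minor_le:
  assumes "\<And>P. P \<in> set Ps \<Longrightarrow> degree P \<le> n"
  shows "degree (minor Ps is) \<le> n * length Ps"
  unfolding minor_def
proof (rule degree_det_le)
  fix i j assume ij: "i < length Ps" "j < length Ps"
  have "degree ((pderiv ^^ (is ! j)) (Ps ! i)) \<le> degree (Ps ! i)" by (simp add: degree_higher_pderiv)
  also have "\<dots> \<le> n" using assms ij by simp
  finally show "degree (mat (length Ps) (length Ps) (\<lambda>(a, b). (pderiv ^^ (is ! b)) (Ps ! a)) $$ (i, j)) \<le> n"
    using ij by simp
qed auto

definition integral_coeffs :: "real poly \<Rightarrow> bool" where
  "integral_coeffs p \<longleftrightarrow> (\<forall>i. coeff p i \<in> \<int>)"

lemma integral_coeffs_mult: "integral_coeffs p \<Longrightarrow> integral_coeffs q \<Longrightarrow> integral_coeffs (p * q)"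
  unfolding integral_coeffs_def by (auto simp: coeff_mult intro!: Ints_sum)

lemma integral_coeffs_sum: "(\<And>a. a \<in> A \<Longrightarrow> integral_coeffs (f a)) \<Longrightarrow> integral_coeffs (sum f A)"
  unfolding integral_coeffs_def by (auto simp: coeff_sum intro!: Ints_sum)

lemma integral_coeffs_1: "integral_coeffs 1"
  by (simp add: integral_coeffs_def coeff_1)

lemma integral_coeffs_prod: "(\<And>a. a \<in> A \<Longrightarrow> integral_coeffs (f a)) \<Longrightarrow> integral_coeffs (prod f A)"
  by (induction A rule: infinite_finite_induct)
     (auto intro!: integral_coeffs_mult simp: integral_coeffs_1)

lemma integral_coeffs_higher_pderiv: "integral_coeffs p \<Longrightarrow> integral_coeffs ((pderiv ^^ i) p)"
  by (induction i) (auto simp: integral_coeffs_def coeff_pderiv intro!: Ints_mult Ints_add)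

lemma integral_coeffs_minor:
  assumes "\<And>P. P \<in> set Ps \<Longrightarrow> integral_coeffs P"
  shows "integral_coeffs (minor Ps is)"
proof -
  define k where "k = length Ps"
  define A where "A = mat k k (\<lambda>(a, b). (pderiv ^^ (is ! b)) (Ps ! a))"
  have entry: "integral_coeffs (A $$ (a, b))" if "a < k" "b < k" for a b
    using that assms by (auto simp: A_def k_def intro!: integral_coeffs_higher_pderiv)
  have "integral_coeffs (signof q * (\<Prod>i = 0..<k. A $$ (i, q i)))" if "q permutes {0..<k}" for q
  proof (rule integral_coeffs_mult)
    show "integral_coeffs (signof q)" by (auto simp: sign_def integral_coeffs_def coeff_1)
    show "integral_coeffs (\<Prod>i = 0..<k. A $$ (i, q i))"
      using entry permutes_in_image[OF that] by (intro integral_coeffs_prod) auto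
  qed
  then have "integral_coeffs (Determinant.det A)"
    by (subst det_def'[of _ k]) (auto simp: A_def intro!: integral_coeffs_sum)
  then show ?thesis by (simp add: minor_def A_def k_def)
qed

section \<open>Weighted covolumes\<close>

definition index_lists :: "nat \<Rightarrow> nat \<Rightarrow> nat list set" where
  "index_lists n k = {is. set is \<subseteq> {..n} \<and> length is = k}"

lemma finite_index_lists: "finite (index_lists n k)"
  unfolding index_lists_def by (rule finite_lists_length_eq) simp

lemma card_index_lists: "card (index_lists n k) = (n + 1) ^ k"
  unfolding index_lists_def by (subst card_lists_length_eq) auto

text \<open>
  The squared norm of the exterior product of the vectors of weighted derivatives, up to the constant
  factor that comes from listing each set of columns in every order (and from lists with repetitions,
  for which the minor is 0). The square keeps it a polynomial in the point.
\<close>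

definition covol :: "(nat \<Rightarrow> real) \<Rightarrow> nat \<Rightarrow> real poly list \<Rightarrow> real poly" where
  "covol w n Ps = (\<Sum>is\<in>index_lists n (length Ps). smult ((\<Prod>i\<leftarrow>is. w i)\<^sup>2) ((minor Ps is)\<^sup>2))"

lemma poly_covol:
  "poly (covol w n Ps) x = (\<Sum>is\<in>index_lists n (length Ps). ((\<Prod>i\<leftarrow>is. w i) * poly (minor Ps is) x)\<^sup>2)"
  by (simp add: covol_def poly_sum power_mult_distrib)

lemma covol_nonneg: "0 \<le> poly (covol w n Ps) x"
  unfolding poly_covol by (intro sum_nonneg) auto

lemma covol_Nil: "covol w n [] = 1"
proof -
  have "index_lists n 0 = {[]}" by (auto simp: index_lists_def)
  moreover have "minor [] [] = 1" by (simp add: minor_def)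
  ultimately show ?thesis by (simp add: covol_def)
qed

lemma covol_ge_minor:
  assumes "is \<in> index_lists n (length Ps)"
  shows "((\<Prod>i\<leftarrow>is. w i) * poly (minor Ps is) x)\<^sup>2 \<le> poly (covol w n Ps) x"
  unfolding poly_covol using assms
  by (intro member_le_sum[of "is" _ "\<lambda>is. ((\<Prod>i\<leftarrow>is. w i) * poly (minor Ps is) x)\<^sup>2"])
     (auto simp: finite_index_lists)

lemma covol_ge_wronskian:
  assumes "length Ps \<le> n + 1"
  shows "((\<Prod>i<length Ps. w i) * poly (minor Ps [0..<length Ps]) x)\<^sup>2 \<le> poly (covol w n Ps) x"
proof -
  have "(\<Prod>i\<leftarrow>[0..<length Ps]. w i) = (\<Prod>i<length Ps. w i)"
    by (simp add: prod.list_conv_set_nth lessThan_atLeast0)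
  moreover have "[0..<length Ps] \<in> index_lists n (length Ps)" using assms by (auto simp: index_lists_def)
  ultimately show ?thesis using covol_ge_minor by metis
qed

lemma degree_covol_le:
  assumes "\<And>P. P \<in> set Ps \<Longrightarrow> degree P \<le> n"
  shows "degree (covol w n Ps) \<le> 2 * (n * length Ps)"
  unfolding covol_def
proof (intro degree_sum_le finite_index_lists)
  fix "is"
  have "degree ((minor Ps is)\<^sup>2) \<le> degree (minor Ps is) * 2" by (rule degree_power_le)
  also have "\<dots> \<le> 2 * (n * length Ps)" using degree_minor_le[of Ps n "is"] assms by simp
  finally show "degree (smult ((\<Prod>i\<leftarrow>is. w i)\<^sup>2) ((minor Ps is)\<^sup>2)) \<le> 2 * (n * length Ps)"
    using degree_smult_le le_trans by blast
qed

lemma covol_basis_change: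
  assumes "length Ps = length Qs" "distinct Qs" "set Ps \<subseteq> rp.span (set Qs)"
  obtains t where "0 \<le> t" "covol w n Ps = smult t (covol w n Qs)"
proof -
  obtain t where t: "\<And>is. minor Ps is = smult t (minor Qs is)"
    using minor_basis_change assms by metis
  have "covol w n Ps = smult (t\<^sup>2) (covol w n Qs)"
    unfolding covol_def by (simp add: t assms(1) rp.scale_sum_right power2_eq_square mult_ac)
  then show ?thesis using that[of "t\<^sup>2"] by simp
qed

text \<open>
  Laplace expansion along the row of the new vector.
\<close>

lemma abs_weighted_minor_Cons_le:
  assumes "is": "is \<in> index_lists n (Suc (length Ps))" and w: "\<And>i. 0 \<le> w i"
    and \<theta>: "\<And>i. i \<le> n \<Longrightarrow> w i * \<bar>poly ((pderiv ^^ i) v) x\<bar> \<le> \<theta>"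
  shows "\<bar>(\<Prod>i\<leftarrow>is. w i) * poly (minor (v # Ps) is) x\<bar>
    \<le> Suc (length Ps) * (\<theta> * sqrt (poly (covol w n Ps) x))"
proof -
  define del where "del = (\<lambda>j. take j is @ drop (Suc j) is)"
  have len: "length is = Suc (length Ps)" using "is" by (simp add: index_lists_def)
  have \<theta>0: "0 \<le> \<theta>" using \<theta>[of 0] w[of 0] by (meson abs_ge_zero le0 mult_nonneg_nonneg order_trans)
  have split: "(\<Prod>i\<leftarrow>is. w i) = w (is ! j) * (\<Prod>i\<leftarrow>del j. w i)" if "j < length is" for j
    by (subst id_take_nth_drop[OF that]) (simp add: del_def)
  have "(\<Prod>i\<leftarrow>is. w i) * poly (minor (v # Ps) is) x =
    (\<Sum>j<length is. (\<Prod>i\<leftarrow>is. w i) * ((-1) ^ j * poly ((pderiv ^^ (is ! j)) v) x * poly (minor Ps (del j)) x))"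
    by (simp add: minor_Cons[OF len] del_def poly_sum sum_distrib_left poly_power)
  also have "\<bar>\<dots>\<bar> \<le> (\<Sum>j<length is. \<theta> * sqrt (poly (covol w n Ps) x))"
  proof (rule order_trans[OF sum_abs], rule sum_mono)
    fix j assume "j \<in> {..<length is}"
    then have j: "j < length is" by simp
    have del: "del j \<in> index_lists n (length Ps)"
      using "is" j unfolding index_lists_def del_def
      by (auto dest: in_set_takeD in_set_dropD)
    have 1: "w (is ! j) * \<bar>poly ((pderiv ^^ (is ! j)) v) x\<bar> \<le> \<theta>"
    proof (rule \<theta>)
      have "is ! j \<in> {..n}" using nth_mem[OF j] "is" unfolding index_lists_def by blast
      then show "is ! j \<le> n" by simp
    qed
    have 2: "\<bar>(\<Prod>i\<leftarrow>del j. w i) * poly (minor Ps (del j)) x\<bar> \<le> sqrt (poly (covol w n Ps) x)"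
      using covol_ge_minor[OF del, of w x] by (simp add: real_le_rsqrt)
    have "\<bar>(\<Prod>i\<leftarrow>is. w i) * ((-1) ^ j * poly ((pderiv ^^ (is ! j)) v) x * poly (minor Ps (del j)) x)\<bar>
      = (w (is ! j) * \<bar>poly ((pderiv ^^ (is ! j)) v) x\<bar>) * \<bar>(\<Prod>i\<leftarrow>del j. w i) * poly (minor Ps (del j)) x\<bar>"
      using w by (simp add: split[OF j] abs_mult power_abs mult_ac)
    also have "\<dots> \<le> \<theta> * sqrt (poly (covol w n Ps) x)"
      by (rule mult_mono[OF 1 2 \<theta>0]) auto
    finally show "\<bar>(\<Prod>i\<leftarrow>is. w i) * ((-1) ^ j * poly ((pderiv ^^ (is ! j)) v) x * poly (minor Ps (del j)) x)\<bar>
      \<le> \<theta> * sqrt (poly (covol w n Ps) x)" .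
  qed
  also have "\<dots> = Suc (length Ps) * (\<theta> * sqrt (poly (covol w n Ps) x))" by (simp add: len)
  finally show ?thesis .
qed

text \<open>
  The counterpart of Hadamard's inequality, with a constant: adjoining a vector with
  entries at most \<open>\<theta>\<close> multiplies the covolume by \<open>O(\<theta>\<^sup>2)\<close>.
\<close>

lemma covol_Cons_le:
  assumes w: "\<And>i. 0 \<le> w i" and len: "length Ps \<le> n"
    and \<theta>: "\<And>i. i \<le> n \<Longrightarrow> w i * \<bar>poly ((pderiv ^^ i) v) x\<bar> \<le> \<theta>"
  shows "poly (covol w n (v # Ps)) x \<le> real (n + 1) ^ (n + 3) * \<theta>\<^sup>2 * poly (covol w n Ps) x"
proof -
  let ?c = "poly (covol w n Ps) x" and ?k = "Suc (length Ps)"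
  have "poly (covol w n (v # Ps)) x
      = (\<Sum>is\<in>index_lists n ?k. ((\<Prod>i\<leftarrow>is. w i) * poly (minor (v # Ps) is) x)\<^sup>2)"
    by (simp add: poly_covol)
  also have "\<dots> \<le> (\<Sum>is\<in>index_lists n ?k. real (n + 1) ^ 2 * \<theta>\<^sup>2 * ?c)"
  proof (rule sum_mono)
    fix "is" assume "is": "is \<in> index_lists n ?k"
    have "((\<Prod>i\<leftarrow>is. w i) * poly (minor (v # Ps) is) x)\<^sup>2 \<le> (?k * (\<theta> * sqrt ?c))\<^sup>2"
      using abs_weighted_minor_Cons_le[OF "is" w \<theta>]
      by (metis abs_ge_zero power2_abs power_mono)
    also have "\<dots> = real ?k ^ 2 * \<theta>\<^sup>2 * ?c" by (simp add: power_mult_distrib covol_nonneg)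
    also have "\<dots> \<le> real (n + 1) ^ 2 * \<theta>\<^sup>2 * ?c"
      using len by (intro mult_right_mono power_mono) (auto simp: covol_nonneg)
    finally show "((\<Prod>i\<leftarrow>is. w i) * poly (minor (v # Ps) is) x)\<^sup>2 \<le> real (n + 1) ^ 2 * \<theta>\<^sup>2 * ?c" .
  qed
  also have "\<dots> = real (n + 1) ^ ?k * (real (n + 1) ^ 2 * \<theta>\<^sup>2 * ?c)"
    by (simp add: card_index_lists algebra_simps)
  also have "\<dots> \<le> real (n + 1) ^ (n + 1) * (real (n + 1) ^ 2 * \<theta>\<^sup>2 * ?c)"
    using len by (intro mult_right_mono power_increasing) (auto simp: covol_nonneg)
  also have "\<dots> = real (n + 1) ^ (n + 3) * \<theta>\<^sup>2 * ?c" by (simp add: power_add eval_nat_numeral)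
  finally show ?thesis .
qed

lemma covol_nonzero:
  assumes "rp.independent (set Ps)" "distinct Ps" "length Ps \<le> n + 1" "\<And>i. 0 < w i"
  shows "covol w n Ps \<noteq> 0"
proof
  assume 0: "covol w n Ps = 0"
  obtain y where "poly (minor Ps [0..<length Ps]) y \<noteq> 0"
    using wronskian_nonzero[OF assms(1,2)] poly_all_0_iff_0 by blast
  moreover have "0 < (\<Prod>i<length Ps. w i)" using assms(4) by (simp add: prod_pos)
  ultimately have "0 < ((\<Prod>i<length Ps. w i) * poly (minor Ps [0..<length Ps]) y)\<^sup>2"
    by (metis less_irrefl mult_eq_0_iff zero_less_power2)
  then show False using covol_ge_wronskian[OF assms(3), of w y] 0 by simp
qed

section \<open>Subspaces spanned by a finite set of polynomials\<close>

lemma independent_degree_bound: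
  assumes "rp.independent A" "\<And>P. P \<in> A \<Longrightarrow> degree P \<le> n"
  shows "finite A \<and> card A \<le> n + 1"
proof -
  let ?M = "(\<lambda>i. monom (1::real) i) ` {..n}"
  have "A \<subseteq> rp.span ?M"
  proof
    fix P assume "P \<in> A"
    then have "P = (\<Sum>i\<le>n. monom (coeff P i) i)" using poly_as_sum_of_monoms'[of P n] assms(2) by simp
    also have "\<dots> = (\<Sum>i\<le>n. smult (coeff P i) (monom 1 i))" by (simp add: smult_monom)
    also have "\<dots> \<in> rp.span ?M"
      by (intro rp.span_sum rp.span_scale rp.span_base) auto
    finally show "P \<in> rp.span ?M" .
  qed
  then have "finite A \<and> card A \<le> card ?M"
    using rp.independent_span_bound[of ?M A] assms(1) by blast
  moreover have "card ?M \<le> card {..n}" by (rule card_image_le) simp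
  ultimately show ?thesis by simp
qed

lemma card_lt_of_span_psubset:
  assumes "rp.independent A" "rp.independent B" "finite B" "rp.span A \<subset> rp.span B"
  shows "card A < card B"
proof -
  obtain v where v: "v \<in> rp.span B" "v \<notin> rp.span A" using assms(4) by blast
  have ind: "rp.independent (insert v A)"
    using assms(1) v(2) by (simp add: rp.independent_insert)
  have sub: "insert v A \<subseteq> rp.span B" using v(1) assms(4) rp.span_superset[of A] by auto
  have fc: "finite (insert v A) \<and> card (insert v A) \<le> card B"
    by (rule rp.independent_span_bound[OF assms(3) ind sub])
  have "v \<notin> A" using v(2) rp.span_base[of v A] by blast
  then have "card (insert v A) = Suc (card A)" using fc by (intro card_insert_disjoint) auto
  then show ?thesis using fc by linarith
qed

lemma card_eq_of_span_eq:
  assumes "rp.independent A" "rp.independent B" "finite A" "finite B" "rp.span A = rp.span B"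
  shows "card A = card B"
  using rp.independent_span_bound[OF assms(3,2)] rp.independent_span_bound[OF assms(4,1)] assms(5)
    rp.span_superset[of A] rp.span_superset[of B] by (simp add: order_antisym)

definition bases_in :: "real poly set \<Rightarrow> real poly set \<Rightarrow> real poly list set" where
  "bases_in F V = {Ps. distinct Ps \<and> set Ps \<subseteq> F \<and> rp.independent (set Ps) \<and> rp.span (set Ps) = V}"

lemma finite_bases_in: "finite F \<Longrightarrow> finite (bases_in F V)"
  by (rule finite_subset[OF _ finite_subset_distinct]) (auto simp: bases_in_def)

lemma bases_in_nonempty:
  assumes "A \<subseteq> F" "finite F"
  shows "bases_in F (rp.span A) \<noteq> {}"
proof -
  obtain B where B: "B \<subseteq> A" "rp.independent B" "A \<subseteq> rp.span B"
    using rp.maximal_independent_subset[of A] by blast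
  have "finite B" by (rule finite_subset[OF subset_trans[OF B(1) assms(1)] assms(2)])
  then obtain Ps where Ps: "set Ps = B" "distinct Ps" using finite_distinct_list by blast
  have "rp.span B = rp.span A" using B(1,3) rp.span_superset[of A] by (auto simp: rp.span_eq)
  then have "Ps \<in> bases_in F (rp.span A)" using Ps B assms(1) by (auto simp: bases_in_def)
  then show ?thesis by blast
qed

text \<open>
  The covolume of a subspace should be that of the densest basis available in \<open>F\<close>. Because the
  covolumes of two bases differ by a constant factor, the leading coefficient decides which
  basis is densest, at all points simultaneously.
\<close>

definition min_basis :: "(nat \<Rightarrow> real) \<Rightarrow> nat \<Rightarrow> real poly set \<Rightarrow> real poly set \<Rightarrow> real poly list" where
  "min_basis w n F V = arg_min_on (\<lambda>Ps. \<bar>lead_coeff (covol w n Ps)\<bar>) (bases_in F V)"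

lemma min_basis_in_bases:
  assumes "A \<subseteq> F" "finite F"
  shows "min_basis w n F (rp.span A) \<in> bases_in F (rp.span A)"
  unfolding min_basis_def
  using arg_min_if_finite(1)[OF finite_bases_in[OF assms(2)] bases_in_nonempty[OF assms]] .

lemma covol_min_basis_le:
  assumes F: "finite F" "\<And>P. P \<in> F \<Longrightarrow> degree P \<le> n" and w: "\<And>i. 0 < w i"
    and Ps: "Ps \<in> bases_in F V"
  shows "poly (covol w n (min_basis w n F V)) x \<le> poly (covol w n Ps) x"
proof -
  define Qs where "Qs = min_basis w n F V"
  let ?f = "\<lambda>Ps. \<bar>lead_coeff (covol w n Ps)\<bar>"
  have ne: "bases_in F V \<noteq> {}" using Ps by blast
  have Qs: "Qs \<in> bases_in F V" "\<not> ?f Ps < ?f Qs"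
    using arg_min_if_finite[OF finite_bases_in[OF F(1)] ne, of ?f] Ps
    unfolding Qs_def min_basis_def by blast+
  have P: "distinct Ps" "rp.independent (set Ps)" "rp.span (set Ps) = V"
    and Q: "distinct Qs" "set Qs \<subseteq> F" "rp.independent (set Qs)" "rp.span (set Qs) = V"
    using Ps Qs(1) by (auto simp: bases_in_def)
  have "length Ps = length Qs"
    using card_eq_of_span_eq[OF P(2) Q(3)] P Q by (simp add: distinct_card)
  moreover have "set Ps \<subseteq> rp.span (set Qs)" using P(3) Q(4) rp.span_superset[of "set Ps"] by simp
  ultimately obtain t where t: "0 \<le> t" "covol w n Ps = smult t (covol w n Qs)"
    using covol_basis_change[of Ps Qs w n] Q(1) by blast
  have "length Qs \<le> n + 1"
    using independent_degree_bound[OF Q(3), of n] F(2) Q(1,2) distinct_card[OF Q(1)] by auto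
  then have "covol w n Qs \<noteq> 0" by (rule covol_nonzero[OF Q(3,1) _ w])
  then have "0 < ?f Qs" by simp
  moreover have "?f Ps = t * ?f Qs" using t by (simp add: abs_mult)
  ultimately have "1 \<le> t" using Qs(2) by (simp add: not_less)
  then have "1 * poly (covol w n Qs) x \<le> t * poly (covol w n Qs) x"
    by (intro mult_right_mono covol_nonneg)
  then show ?thesis unfolding Qs_def[symmetric] t by simp
qed

text \<open>
  Let \<open>U\<close> be the largest member of the flag that does not contain the short vector \<open>v\<close>, or the zero
  space if there is none, and let \<open>V\<close> be spanned by \<open>U\<close> and \<open>v\<close>. Members of the flag that contain \<open>v\<close>
  contain \<open>U\<close> and hence \<open>V\<close>, and the other members lie in \<open>U\<close>, so \<open>V\<close> is comparable with the whole
  flag. Therefore its covolume is at least \<open>\<epsilon>\<close>. But the covolume of \<open>U\<close> is at most 1 and \<open>v\<close> is short,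
  so that of \<open>V\<close> is less than \<open>\<epsilon>\<close>.
\<close>

lemma marked_imp_no_small_vector:
  assumes F: "finite F" "\<And>P. P \<in> F \<Longrightarrow> degree P \<le> n" and w: "\<And>i. 0 < w i"
    and marked: "marked (\<lambda>U V. U \<subseteq> V \<or> V \<subseteq> U) (\<lambda>V. covol w n (min_basis w n F V)) \<epsilon> (rp.span ` Pow F) x"
    and \<epsilon>: "\<epsilon> \<le> 1" "real (n + 1) ^ (n + 3) * \<theta>\<^sup>2 < \<epsilon>"
    and v: "v \<in> F" "v \<noteq> 0" "\<And>i. i \<le> n \<Longrightarrow> w i * \<bar>poly ((pderiv ^^ i) v) x\<bar> \<le> \<theta>"
  shows False
proof -
  define p where "p = (\<lambda>V. covol w n (min_basis w n F V))"
  obtain T where T: "T \<subseteq> rp.span ` Pow F" "\<forall>U\<in>T. \<forall>V\<in>T. U \<subseteq> V \<or> V \<subseteq> U"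
    "\<forall>V\<in>T. \<epsilon> \<le> poly (p V) x \<and> poly (p V) x \<le> 1"
    "\<forall>V\<in>rp.span ` Pow F - T. (\<forall>U\<in>T. V \<subseteq> U \<or> U \<subseteq> V) \<longrightarrow> 1 \<le> poly (p V) x"
    using marked unfolding marked_def p_def by auto
  have finT: "finite T" using T(1) F(1) finite_subset by blast
  have "\<exists>A\<subseteq>F. v \<notin> rp.span A \<and> poly (p (rp.span A)) x \<le> 1 \<and> (\<forall>U\<in>T. v \<notin> U \<longrightarrow> U \<subseteq> rp.span A) \<and>
      (\<forall>U\<in>T. v \<in> U \<longrightarrow> rp.span A \<subseteq> U)"
  proof (cases "{U\<in>T. v \<notin> U} = {}")
    case True
    define Ps where "Ps = min_basis w n F (rp.span {})"
    have "Ps \<in> bases_in F (rp.span {})" unfolding Ps_def by (rule min_basis_in_bases) (use F in auto)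
    then have "set Ps \<subseteq> {0}" "0 \<notin> set Ps"
      using rp.span_superset[of "set Ps"] rp.dependent_zero[of "set Ps"] by (auto simp: bases_in_def)
    then have "set Ps = {}" using subset_singletonD by fastforce
    then have "covol w n Ps = 1" by (simp add: covol_Nil)
    then have "p (rp.span {}) = 1" by (simp only: p_def Ps_def)
    moreover have "rp.span {} \<subseteq> U" if "U \<in> T" for U
      using T(1) that rp.span_zero by auto
    ultimately show ?thesis using True v(2) by (intro exI[of _ "{}"]) auto
  next
    case False
    then obtain M where M: "M \<in> {U\<in>T. v \<notin> U}" "\<And>U. U \<in> {U\<in>T. v \<notin> U} \<Longrightarrow> M \<subseteq> U \<Longrightarrow> M = U"
      using finite_has_maximal[of "{U\<in>T. v \<notin> U}"] finT by auto
    obtain A where A: "A \<subseteq> F" "M = rp.span A" using M(1) T(1) by auto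
    have "U \<subseteq> M" if "U \<in> T" "v \<notin> U" for U using M T(2) that by blast
    moreover have "M \<subseteq> U" if "U \<in> T" "v \<in> U" for U using M(1) T(2) that by blast
    ultimately show ?thesis using A M(1) T(3) by (intro exI[of _ A]) auto
  qed
  then obtain A where "A \<subseteq> F \<and> v \<notin> rp.span A \<and> poly (p (rp.span A)) x \<le> 1 \<and>
      (\<forall>U\<in>T. v \<notin> U \<longrightarrow> U \<subseteq> rp.span A) \<and> (\<forall>U\<in>T. v \<in> U \<longrightarrow> rp.span A \<subseteq> U)"
    by (elim exE) (rule that)
  then have A: "A \<subseteq> F" "v \<notin> rp.span A" "poly (p (rp.span A)) x \<le> 1"
    and below: "\<And>U. U \<in> T \<Longrightarrow> v \<notin> U \<Longrightarrow> U \<subseteq> rp.span A"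
    and above: "\<And>U. U \<in> T \<Longrightarrow> v \<in> U \<Longrightarrow> rp.span A \<subseteq> U" by simp_all
  define Ps where "Ps = min_basis w n F (rp.span A)"
  have Ps: "distinct Ps" "set Ps \<subseteq> F" "rp.independent (set Ps)" "rp.span (set Ps) = rp.span A"
    using min_basis_in_bases[OF A(1) F(1), of w n] by (auto simp: Ps_def bases_in_def)
  have v_notin: "v \<notin> set Ps" using A(2) Ps(4) rp.span_base[of v "set Ps"] by auto
  have ind: "rp.independent (set (v # Ps))"
    using A(2) Ps(3,4) by (simp add: rp.independent_insert)
  define V where "V = rp.span (set (v # Ps))"
  have VS: "V \<in> rp.span ` Pow F" using v(1) Ps(2) by (auto simp: V_def)
  have basis: "v # Ps \<in> bases_in F V" using ind Ps v_notin v(1) by (auto simp: bases_in_def V_def)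
  have comparable: "V \<subseteq> U \<or> U \<subseteq> V" if U: "U \<in> T" for U
  proof (cases "v \<in> U")
    case True
    obtain B where B: "U = rp.span B" using T(1) U by auto
    have "set (v # Ps) \<subseteq> U" using True above[OF U] Ps(4) rp.span_superset[of "set Ps"] by auto
    then have "V \<subseteq> U" unfolding V_def B using rp.span_mono[of "set (v # Ps)" "rp.span B"] by (simp add: rp.span_span)
    then show ?thesis by simp
  next
    case False
    then have "U \<subseteq> rp.span (set Ps)" using below[OF U] Ps(4) by simp
    also have "\<dots> \<subseteq> V" unfolding V_def by (rule rp.span_mono) auto
    finally show ?thesis by simp
  qed
  have lower: "\<epsilon> \<le> poly (p V) x"
  proof (cases "V \<in> T")
    case True
    then show ?thesis using T(3) by simp
  next
    case False
    then have "V \<in> rp.span ` Pow F - T" using VS by simp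
    moreover have "\<forall>U\<in>T. V \<subseteq> U \<or> U \<subseteq> V" by (intro ballI comparable)
    ultimately have "1 \<le> poly (p V) x" using T(4) by simp
    then show ?thesis using \<epsilon>(1) by linarith
  qed
  have "length (v # Ps) \<le> n + 1"
    using independent_degree_bound[OF ind, of n] F(2) Ps(2) v(1) v_notin distinct_card[of "v # Ps"] Ps(1) by auto
  then have len: "length Ps \<le> n" by simp
  have "poly (p V) x \<le> poly (covol w n (v # Ps)) x"
    unfolding p_def by (rule covol_min_basis_le[OF F w basis])
  also have "\<dots> \<le> real (n + 1) ^ (n + 3) * \<theta>\<^sup>2 * poly (covol w n Ps) x"
    by (rule covol_Cons_le[OF _ len v(3)]) (use w less_imp_le in auto)
  also have "\<dots> \<le> real (n + 1) ^ (n + 3) * \<theta>\<^sup>2 * 1"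
    using A(3) by (intro mult_left_mono) (auto simp: p_def Ps_def)
  finally show False using lower \<epsilon>(2) by simp
qed

section \<open>Quantitative nondivergence\<close>

text \<open>
  The finite set \<open>F\<close> keeps the family of subspaces finite, and the bound is uniform in \<open>F\<close>. The condition relating \<open>\<eta>\<close> and \<open>w\<close> says that the weighted Wronskians reach
  1 in absolute value on \<open>[a, b]\<close>, once \<open>\<eta>\<close> bounds the supremum of the unweighted ones from below.
\<close>

lemma small_vector_measure:
  assumes F: "finite F" "\<And>P. P \<in> F \<Longrightarrow> degree P \<le> n" "\<And>P. P \<in> F \<Longrightarrow> integral_coeffs P"
    and w: "\<And>i. 0 < w i" and ab: "a \<le> b"
    and \<eta>: "\<And>p. p \<noteq> 0 \<Longrightarrow> integral_coeffs p \<Longrightarrow> degree p \<le> n * (n + 1) \<Longrightarrow> \<exists>y\<in>{a..b}. \<eta> \<le> \<bar>poly p y\<bar>"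
    and \<eta>w: "0 \<le> \<eta>" "\<And>k. 0 < k \<Longrightarrow> k \<le> n + 1 \<Longrightarrow> 1 \<le> \<eta> * (\<Prod>i<k. w i)"
    and \<delta>: "0 < \<delta>" "\<delta> \<le> 1/2" "real (n + 1) ^ (n + 3) * \<theta>\<^sup>2 < \<delta> ^ (2 * n * (n + 1))"
  defines "K \<equiv> 8 * real (2 * n * (n + 1)) * real (n + 2) * 2 ^ (n + 2)"
  shows "\<exists>E\<in>sets lborel.
      {x\<in>{a..b}. \<exists>v\<in>F. v \<noteq> 0 \<and> (\<forall>i\<le>n. w i * \<bar>poly ((pderiv ^^ i) v) x\<bar> \<le> \<theta>)} \<subseteq> E \<and>
      emeasure lborel E \<le> ennreal (K * \<delta> * (b - a))"
proof -
  define S where "S = rp.span ` Pow F"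
  define B where "B = min_basis w n F"
  define D where "D = 2 * n * (n + 1)"
  define inc :: "real poly set \<Rightarrow> real poly set \<Rightarrow> bool" where "inc = (\<lambda>U V. U \<subseteq> V \<or> V \<subseteq> U)"
  have finS: "finite S" using F(1) by (simp add: S_def)
  have B: "distinct (B V)" "set (B V) \<subseteq> F" "rp.independent (set (B V))" "rp.span (set (B V)) = V"
    if "V \<in> S" for V
    using that min_basis_in_bases[OF _ F(1), of _ w n] by (auto simp: S_def B_def bases_in_def)
  have len: "length (B V) \<le> n + 1" if "V \<in> S" for V
    using independent_degree_bound[OF B(3)[OF that], of n] B(2)[OF that] F(2) distinct_card[OF B(1)[OF that]] by auto
  have deg: "degree (covol w n (B V)) \<le> D" if V: "V \<in> S" for V
  proof -
    have "degree (covol w n (B V)) \<le> 2 * (n * length (B V))"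
      using B(2)[OF V] F(2) by (intro degree_covol_le) auto
    also have "\<dots> \<le> 2 * (n * (n + 1))" using len[OF V] by (intro mult_le_mono2)
    also have "\<dots> = D" by (simp add: D_def)
    finally show ?thesis .
  qed
  have sup: "\<exists>y\<in>{a..b}. 1 \<le> poly (covol w n (B V)) y" if V: "V \<in> S" for V
  proof (cases "B V = []")
    case True
    then show ?thesis using ab by (auto simp: covol_Nil)
  next
    case False
    define k where "k = length (B V)"
    define W where "W = minor (B V) [0..<k]"
    have k: "0 < k" "k \<le> n + 1" using False len[OF V] by (auto simp: k_def)
    have "W \<noteq> 0" unfolding W_def k_def by (rule wronskian_nonzero[OF B(3,1)[OF V]])
    moreover have "integral_coeffs W"
      unfolding W_def by (rule integral_coeffs_minor) (use B(2)[OF V] F(3) in auto)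
    moreover have "degree W \<le> n * (n + 1)"
    proof -
      have "degree W \<le> n * k" unfolding W_def k_def using B(2)[OF V] F(2) by (intro degree_minor_le) auto
      also have "\<dots> \<le> n * (n + 1)" using k(2) by (rule mult_le_mono2)
      finally show ?thesis .
    qed
    ultimately obtain y where y: "y \<in> {a..b}" "\<eta> \<le> \<bar>poly W y\<bar>" using \<eta> by blast
    have w0: "0 \<le> (\<Prod>i<k. w i)" using w by (intro prod_nonneg) (auto intro: less_imp_le)
    have "1 \<le> \<eta> * (\<Prod>i<k. w i)" using \<eta>w(2) k by blast
    also have "\<dots> \<le> \<bar>poly W y\<bar> * (\<Prod>i<k. w i)" using y(2) w0 by (rule mult_right_mono)
    also have "\<dots> = \<bar>(\<Prod>i<k. w i) * poly W y\<bar>" using w0 by (simp add: abs_mult)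
    finally have "1 \<le> ((\<Prod>i<k. w i) * poly W y)\<^sup>2" by (metis abs_one abs_le_square_iff one_power2)
    also have "\<dots> \<le> poly (covol w n (B V)) y"
      using covol_ge_wronskian[OF len[OF V], of w y] by (simp add: W_def k_def)
    finally show ?thesis using y(1) by blast
  qed
  have rank: "length (B U) \<noteq> length (B V)" if U: "U \<in> S" and V: "V \<in> S" and "inc U V" "U \<noteq> V" for U V
  proof -
    have card: "length (B X) = card (set (B X))" if "X \<in> S" for X using B(1)[OF that] by (simp add: distinct_card)
    have "length (B X) < length (B Y)" if "X \<in> S" "Y \<in> S" "X \<subset> Y" for X Y
      using card_lt_of_span_psubset[of "set (B X)" "set (B Y)"] B that card by simp
    then show ?thesis using that unfolding inc_def by (metis less_irrefl psubsetI)
  qed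
  have cardL: "card ((\<lambda>V. length (B V)) ` S) \<le> n + 2"
  proof -
    have "(\<lambda>V. length (B V)) ` S \<subseteq> {..n + 1}" using len by auto
    then have "card ((\<lambda>V. length (B V)) ` S) \<le> card {..n + 1}" by (intro card_mono) auto
    then show ?thesis by simp
  qed
  have "\<exists>E\<in>sets lborel. {x\<in>{a..b}. \<not> marked inc (\<lambda>V. covol w n (B V)) (\<delta> ^ D) S x} \<subseteq> E \<and>
     emeasure lborel E \<le> ennreal (8 * real D * real (n + 2) * 2 ^ (n + 2) * \<delta> * (b - a))"
    by (rule unmarked_measure[where r = "\<lambda>V. length (B V)"])
       (use \<delta> deg covol_nonneg rank finS cardL ab sup in \<open>auto simp: inc_def\<close>)
  then obtain E where E: "E \<in> sets lborel"
    "{x\<in>{a..b}. \<not> marked inc (\<lambda>V. covol w n (B V)) (\<delta> ^ D) S x} \<subseteq> E"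
    "emeasure lborel E \<le> ennreal (K * \<delta> * (b - a))" unfolding K_def D_def by blast
  have "x \<in> E" if x: "x \<in> {a..b}" "v \<in> F" "v \<noteq> 0" "\<forall>i\<le>n. w i * \<bar>poly ((pderiv ^^ i) v) x\<bar> \<le> \<theta>" for x v
  proof (rule ccontr)
    assume "x \<notin> E"
    then have "marked inc (\<lambda>V. covol w n (B V)) (\<delta> ^ D) S x" using E(2) x(1) by blast
    then have mk: "marked (\<lambda>U V. U \<subseteq> V \<or> V \<subseteq> U) (\<lambda>V. covol w n (min_basis w n F V)) (\<delta> ^ D) (rp.span ` Pow F) x"
      by (simp only: inc_def S_def B_def)
    show False
    proof (rule marked_imp_no_small_vector[OF F(1) _ _ mk])
      show "\<delta> ^ D \<le> 1" using \<delta> by (intro power_le_one) auto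
      show "real (n + 1) ^ (n + 3) * \<theta>\<^sup>2 < \<delta> ^ D" using \<delta>(3) by (simp only: D_def)
    qed (use F(2) w x in auto)
  qed
  then show ?thesis using E by blast
qed

lemma finite_integral_polys_bounded:
  "finite {v. integral_coeffs v \<and> degree v \<le> n \<and> (\<forall>i. \<bar>coeff v i\<bar> \<le> real H)}" (is "finite ?F")
proof -
  define Z where "Z = real_of_int ` {- int H..int H}"
  have "?F \<subseteq> Poly ` {xs. set xs \<subseteq> Z \<and> length xs \<le> n + 1}"
  proof
    fix v assume v: "v \<in> ?F"
    have "coeff v i \<in> Z" for i
    proof -
      have "coeff v i \<in> \<int>" using v by (simp add: integral_coeffs_def)
      then obtain z where z: "coeff v i = of_int z" by (rule Ints_cases)
      have "\<bar>real_of_int z\<bar> \<le> real H" using v unfolding z[symmetric] by simp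
      then have "z \<in> {- int H..int H}" by auto
      then show ?thesis unfolding Z_def z by blast
    qed
    then have "set (coeffs v) \<subseteq> Z" by (auto simp: coeffs_def)
    moreover have "length (coeffs v) \<le> n + 1" using v by (simp add: coeffs_def)
    ultimately show "v \<in> Poly ` {xs. set xs \<subseteq> Z \<and> length xs \<le> n + 1}"
      by (intro image_eqI[of _ _ "coeffs v"]) auto
  qed
  moreover have "finite (Poly ` {xs. set xs \<subseteq> Z \<and> length xs \<le> n + 1})"
    by (intro finite_imageI finite_lists_length_le) (simp add: Z_def)
  ultimately show ?thesis by (rule finite_subset)
qed

definition small_at :: "nat \<Rightarrow> (nat \<Rightarrow> real) \<Rightarrow> real poly set \<Rightarrow> real set" where
  "small_at n \<beta> F = {x. \<exists>v\<in>F. v \<noteq> 0 \<and> (\<forall>i\<le>n. \<bar>poly ((pderiv ^^ i) v) x\<bar> < \<beta> i)}"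

lemma small_at_mono: "F \<subseteq> G \<Longrightarrow> small_at n \<beta> F \<subseteq> small_at n \<beta> G"
  unfolding small_at_def by blast

lemma small_at_UN: "small_at n \<beta> (\<Union>H. F H) = (\<Union>H. small_at n \<beta> (F H))"
  by (auto simp: small_at_def)

lemma open_small_at: "open (small_at n \<beta> F)"
proof -
  have "small_at n \<beta> F = (\<Union>v\<in>F - {0}. \<Inter>i\<in>{..n}. (\<lambda>x. \<bar>poly ((pderiv ^^ i) v) x\<bar>) -` {..<\<beta> i})"
    by (auto simp: small_at_def)
  then show ?thesis
    by (auto intro!: open_UN open_INT open_vimage continuous_intros)
qed

definition integral_polys :: "nat \<Rightarrow> real poly set" where
  "integral_polys n = {v. integral_coeffs v \<and> degree v \<le> n}"

text \<open>
  All integral polynomials are reached by letting the bound \<open>H\<close> on the coefficients grow. The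
  estimate is uniform in \<open>H\<close>, so it passes to the increasing union.
\<close>

lemma small_at_measure:
  assumes w: "\<And>i. 0 < w i" and ab: "a \<le> b"
    and \<eta>: "\<And>p. p \<noteq> 0 \<Longrightarrow> integral_coeffs p \<Longrightarrow> degree p \<le> n * (n + 1) \<Longrightarrow> \<exists>y\<in>{a..b}. \<eta> \<le> \<bar>poly p y\<bar>"
    and \<eta>w: "0 \<le> \<eta>" "\<And>k. 0 < k \<Longrightarrow> k \<le> n + 1 \<Longrightarrow> 1 \<le> \<eta> * (\<Prod>i<k. w i)"
    and \<delta>: "0 < \<delta>" "\<delta> \<le> 1/2" "real (n + 1) ^ (n + 3) * \<theta>\<^sup>2 < \<delta> ^ (2 * n * (n + 1))"
  defines "K \<equiv> 8 * real (2 * n * (n + 1)) * real (n + 2) * 2 ^ (n + 2)"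
  shows "emeasure lborel ({a..b} \<inter> small_at n (\<lambda>i. \<theta> / w i) (integral_polys n)) \<le> ennreal (K * \<delta> * (b - a))"
proof -
  define F where "F = (\<lambda>H. {v. integral_coeffs v \<and> degree v \<le> n \<and> (\<forall>i. \<bar>coeff v i\<bar> \<le> real H)})"
  define U where "U = (\<lambda>H. {a..b} \<inter> small_at n (\<lambda>i. \<theta> / w i) (F H))"
  have U: "U H \<in> sets lborel" for H unfolding U_def using open_small_at by auto
  have U_le: "emeasure lborel (U H) \<le> ennreal (K * \<delta> * (b - a))" for H
  proof -
    have finF: "finite (F H)" unfolding F_def by (rule finite_integral_polys_bounded)
    have F': "degree P \<le> n" "integral_coeffs P" if "P \<in> F H" for P using that by (auto simp: F_def)
    have "\<exists>E\<in>sets lborel.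
      {x\<in>{a..b}. \<exists>v\<in>F H. v \<noteq> 0 \<and> (\<forall>i\<le>n. w i * \<bar>poly ((pderiv ^^ i) v) x\<bar> \<le> \<theta>)} \<subseteq> E \<and>
      emeasure lborel E \<le> ennreal (K * \<delta> * (b - a))"
      unfolding K_def by (rule small_vector_measure[where \<eta> = \<eta>]) (assumption | rule finF F' w ab \<eta> \<eta>w \<delta>)+
    then obtain E where E: "E \<in> sets lborel"
      "{x\<in>{a..b}. \<exists>v\<in>F H. v \<noteq> 0 \<and> (\<forall>i\<le>n. w i * \<bar>poly ((pderiv ^^ i) v) x\<bar> \<le> \<theta>)} \<subseteq> E"
      "emeasure lborel E \<le> ennreal (K * \<delta> * (b - a))" by (elim bexE conjE) (rule that)
    have "U H \<subseteq> {x\<in>{a..b}. \<exists>v\<in>F H. v \<noteq> 0 \<and> (\<forall>i\<le>n. w i * \<bar>poly ((pderiv ^^ i) v) x\<bar> \<le> \<theta>)}"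
    proof -
      have "w i * y \<le> \<theta>" if "y < \<theta> / w i" for i y
        using that w[of i] by (simp add: pos_less_divide_eq mult.commute)
      then show ?thesis unfolding U_def small_at_def by blast
    qed
    with E(2) have "U H \<subseteq> E" by (rule subset_trans[rotated])
    then have "emeasure lborel (U H) \<le> emeasure lborel E" using E(1) by (rule emeasure_mono)
    also note E(3)
    finally show ?thesis .
  qed
  have "F H \<subseteq> F H'" if "H \<le> H'" for H H'
    using that unfolding F_def by (auto intro: order_trans)
  then have "incseq U" unfolding incseq_def U_def by (intro allI impI Int_mono subset_refl small_at_mono)
  moreover have "range U \<subseteq> sets lborel" using U by auto
  ultimately have "emeasure lborel (\<Union>H. U H) = (SUP H. emeasure lborel (U H))"
    by (simp add: SUP_emeasure_incseq)
  also have "\<dots> \<le> ennreal (K * \<delta> * (b - a))" using U_le by (simp add: SUP_least)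
  finally have le: "emeasure lborel (\<Union>H. U H) \<le> ennreal (K * \<delta> * (b - a))" .
  have "{a..b} \<inter> small_at n (\<lambda>i. \<theta> / w i) (integral_polys n) \<subseteq> (\<Union>H. U H)"
  proof -
    have "\<exists>H. v \<in> F H" if v: "v \<in> integral_polys n" for v
    proof -
      define H where "H = nat \<lceil>\<Sum>i\<le>n. \<bar>coeff v i\<bar>\<rceil>"
      have "\<bar>coeff v i\<bar> \<le> real H" for i
      proof (cases "i \<le> n")
        case True
        then have "\<bar>coeff v i\<bar> \<le> (\<Sum>i\<le>n. \<bar>coeff v i\<bar>)"
          by (intro member_le_sum[of i "{..n}" "\<lambda>i. \<bar>coeff v i\<bar>"]) auto
        then show ?thesis unfolding H_def by linarith
      next
        case False
        then show ?thesis using v by (simp add: integral_polys_def coeff_eq_0)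
      qed
      then show ?thesis using v by (auto simp: F_def integral_polys_def)
    qed
    then have "integral_polys n \<subseteq> (\<Union>H. F H)" by blast
    then have "small_at n (\<lambda>i. \<theta> / w i) (integral_polys n) \<subseteq> (\<Union>H. small_at n (\<lambda>i. \<theta> / w i) (F H))"
      unfolding small_at_UN[symmetric] by (rule small_at_mono)
    then show ?thesis unfolding U_def by blast
  qed
  moreover have "(\<Union>H. U H) \<in> sets lborel" using U by auto
  ultimately have "emeasure lborel ({a..b} \<inter> small_at n (\<lambda>i. \<theta> / w i) (integral_polys n))
      \<le> emeasure lborel (\<Union>H. U H)" by (intro emeasure_mono)
  also have "\<dots> \<le> ennreal (K * \<delta> * (b - a))" by (rule le)
  finally show ?thesis .
qed

section \<open>Almost everywhere finiteness\<close>

text \<open>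
  Up to \<open>m\<close> the terms are nonnegative and the first is positive; from \<open>m\<close> on the terms are
  nonpositive, so the partial sums are bounded below by the total.
\<close>

lemma partial_sums_pos:
  fixes v :: "nat \<Rightarrow> real"
  assumes "0 < m" "\<And>i. i < m \<Longrightarrow> v i \<ge> 0" "\<And>i. m \<le> i \<Longrightarrow> i \<le> n \<Longrightarrow> v i \<le> 0"
    and "v 0 > 0" "(\<Sum>i=0..n. v i) > 0" and k: "0 < k" "k \<le> n + 1"
  shows "0 < (\<Sum>i<k. v i)"
proof (cases "k \<le> m")
  case True
  have "v 0 \<le> (\<Sum>i<k. v i)" using True k assms(2) by (intro member_le_sum) auto
  then show ?thesis using assms(4) by simp
next
  case False
  have "{0..n} = {..<k} \<union> {k..n}" using k by auto
  then have "(\<Sum>i=0..n. v i) = (\<Sum>i<k. v i) + (\<Sum>i=k..n. v i)"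
    by (simp add: sum.union_disjoint ivl_disj_int)
  moreover have "(\<Sum>i=k..n. v i) \<le> 0" using False assms(3) by (intro sum_nonpos) auto
  ultimately show ?thesis using assms(5) by linarith
qed

text \<open>
  Borel--Cantelli on \<open>[a, b]\<close>. The scale \<open>R j\<close> is chosen so that \<open>R j ^ (n + 1) = \<eta> * 2 powr (j s)\<close>,
  the largest value for which the Wronskians are guaranteed to reach 1 after division by powers of
  \<open>R j\<close>. As \<open>\<delta> j ^ D\<close> is proportional to \<open>(1 / R j)\<^sup>2\<close>, the sequence \<open>\<delta>\<close> is geometric with
  ratio \<open>q < 1\<close>.
\<close>

lemma AE_interval_eventually_not_small:
  fixes v :: "nat \<Rightarrow> real"
  assumes n: "0 < n" and s: "0 < s" "\<And>k. 0 < k \<Longrightarrow> k \<le> n + 1 \<Longrightarrow> s \<le> (\<Sum>i<k. v i)"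
    and c: "0 < c" and ab: "a < b"
  defines "A \<equiv> \<lambda>j. small_at n (\<lambda>i. c * (2 ^ j) powr (- v i)) (integral_polys n)"
  shows "AE x in lborel. x \<in> {a..b} \<longrightarrow> (\<forall>\<^sub>F j in sequentially. x \<notin> A j)"
proof -
  obtain \<eta> :: real where \<eta>: "0 < \<eta>" "\<eta> \<le> 1"
    "\<And>p. p \<noteq> 0 \<Longrightarrow> integral_coeffs p \<Longrightarrow> degree p \<le> n * (n + 1) \<Longrightarrow> \<exists>y\<in>{a..b}. \<eta> \<le> \<bar>poly p y\<bar>"
    using integral_poly_sup_bound[OF ab, of "n * (n + 1)"] unfolding integral_coeffs_def by metis
  define D where "D = 2 * n * (n + 1)"
  have D: "0 < D" using n by (simp add: D_def)
  define N where "N = n + 1"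
  have N: "0 < N" by (simp add: N_def)
  define \<rho> where "\<rho> = \<eta> powr (1 / N)"
  define \<tau> where "\<tau> = 2 powr (s / N)"
  have \<rho>: "0 < \<rho>" "\<rho> ^ N = \<eta>"
    using \<eta>(1) N by (auto simp: \<rho>_def powr_power)
  have \<tau>: "1 < \<tau>" "\<tau> ^ N = 2 powr s"
    using s(1) N by (auto simp: \<tau>_def powr_power)
  define R where "R = (\<lambda>j. \<rho> * \<tau> ^ j)"
  \<comment> \<open>The factor 2 turns the equation for \<open>\<delta> j ^ D\<close> into the strict inequality that is needed.\<close>
  define C where "C = 2 * real (n + 1) ^ (n + 3) * c\<^sup>2 / \<rho>\<^sup>2"
  define q where "q = \<tau> powr (- 2 / D)"
  define \<delta> where "\<delta> = (\<lambda>j. C powr (1 / D) * q ^ j)"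
  have C: "0 < C" using c \<rho> by (simp add: C_def)
  have q: "0 < q" "q < 1" "q ^ D = 1 / \<tau>\<^sup>2"
  proof -
    show "0 < q" "q < 1" using \<tau>(1) D by (auto simp: q_def powr_less_one)
    have "q ^ D = \<tau> powr (- 2)" using \<tau>(1) D by (simp add: q_def powr_power)
    also have "\<dots> = 1 / \<tau>\<^sup>2" using \<tau>(1) by (simp add: powr_minus_divide)
    finally show "q ^ D = 1 / \<tau>\<^sup>2" .
  qed
  have R0: "0 < R j" for j using \<rho> \<tau> by (simp add: R_def)
  have \<delta>D: "\<delta> j ^ D = 2 * (real (n + 1) ^ (n + 3) * (c / R j)\<^sup>2)" for j
  proof -
    have "\<delta> j ^ D = C * (1 / \<tau>\<^sup>2) ^ j"
      using C D q(3) by (simp add: \<delta>_def power_mult_distrib powr_power flip: power_mult) (metis mult.commute power_mult)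
    also have "\<dots> = 2 * (real (n + 1) ^ (n + 3) * (c / R j)\<^sup>2)"
      by (simp add: C_def R_def power_mult_distrib power_divide flip: power_mult) (simp add: mult.commute)
    finally show ?thesis .
  qed
  have \<delta>0: "0 < \<delta> j" for j using C q by (simp add: \<delta>_def)
  obtain j0 where j0: "1 / \<rho> < \<tau> ^ j0" using real_arch_pow[OF \<tau>(1)] by blast
  have evR: "\<forall>\<^sub>F j in sequentially. 1 \<le> R j"
    using eventually_ge_at_top[of j0]
  proof eventually_elim
    case (elim j)
    have "1 / \<rho> \<le> \<tau> ^ j" using j0 power_increasing[OF elim, of \<tau>] \<tau>(1) by linarith
    then show ?case using \<rho>(1) by (simp add: R_def pos_divide_le_eq mult.commute)
  qed
  have "\<delta> \<longlonglongrightarrow> 0"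
    unfolding \<delta>_def using q by (auto intro!: tendsto_mult_right_zero LIMSEQ_realpow_zero)
  then have ev\<delta>: "\<forall>\<^sub>F j in sequentially. \<delta> j < 1/2" by (rule order_tendstoD) simp
  define K where "K = 8 * real D * real (n + 2) * 2 ^ (n + 2)"
  have bound: "emeasure lborel ({a..b} \<inter> A j) \<le> ennreal (K * \<delta> j * (b - a))"
    if j: "1 \<le> R j" "\<delta> j < 1/2" for j
  proof -
    define w where "w = (\<lambda>i. (2 ^ j) powr v i / R j)"
    have w: "0 < w i" for i using R0 by (simp add: w_def)
    have weights: "1 \<le> \<eta> * (\<Prod>i<k. w i)" if k: "0 < k" "k \<le> n + 1" for k
    proof -
      have "R j ^ k \<le> R j ^ N" using j(1) k by (intro power_increasing) (auto simp: N_def)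
      also have "\<dots> = \<eta> * (2 powr s) ^ j"
        by (simp only: R_def power_mult_distrib \<rho>(2) power_mult[symmetric] mult.commute[of j])
           (simp only: power_mult \<tau>(2))
      also have "(2 powr s) ^ j = (2 ^ j) powr s"
        by (simp add: powr_power powr_powr flip: powr_realpow) (simp add: mult.commute)
      also have "\<eta> * \<dots> \<le> \<eta> * (2 ^ j) powr (\<Sum>i<k. v i)"
        using \<eta>(1) s(2)[OF k] by (intro mult_left_mono powr_mono) auto
      also have "(2 ^ j) powr (\<Sum>i<k. v i) = (\<Prod>i<k. (2 ^ j) powr v i)"
        by (simp add: powr_sum)
      finally have "R j ^ k \<le> \<eta> * (\<Prod>i<k. (2 ^ j) powr v i)" .
      moreover have "(\<Prod>i<k. w i) = (\<Prod>i<k. (2 ^ j) powr v i) / R j ^ k"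
        by (simp add: w_def prod_dividef)
      ultimately show ?thesis using R0[of j] by (simp add: pos_le_divide_eq)
    qed
    have small: "real (n + 1) ^ (n + 3) * (c / R j)\<^sup>2 < \<delta> j ^ (2 * n * (n + 1))"
      using \<delta>D[of j] c R0[of j] unfolding D_def by simp
    have "emeasure lborel ({a..b} \<inter> small_at n (\<lambda>i. c / R j / w i) (integral_polys n))
        \<le> ennreal (K * \<delta> j * (b - a))"
      unfolding K_def D_def
      by (rule small_at_measure[where \<eta> = \<eta>])
         (assumption | rule w less_imp_le[OF ab] \<eta>(3) less_imp_le[OF \<eta>(1)] weights \<delta>0 less_imp_le[OF j(2)] small)+
    moreover have "c / R j / w i = c * (2 ^ j) powr (- v i)" for i
      using R0[of j] by (simp add: w_def powr_minus divide_inverse)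
    ultimately show ?thesis by (simp add: A_def)
  qed
  have "AE x in lborel. \<forall>\<^sub>F j in sequentially. x \<in> space lborel - ({a..b} \<inter> A j)"
  proof (rule borel_cantelli_AE1)
    show meas: "{a..b} \<inter> A j \<in> sets lborel" for j unfolding A_def using open_small_at by auto
    show "emeasure lborel ({a..b} \<inter> A j) < \<infinity>" for j
    proof -
      have "emeasure lborel ({a..b} \<inter> A j) \<le> emeasure lborel {a..b}" by (intro emeasure_mono) auto
      also have "\<dots> < \<infinity>" using ab by simp
      finally show ?thesis .
    qed
    show "summable (\<lambda>j. measure lborel ({a..b} \<inter> A j))"
    proof (rule summable_comparison_test_ev)
      show "\<forall>\<^sub>F j in sequentially. norm (measure lborel ({a..b} \<inter> A j)) \<le> K * \<delta> j * (b - a)"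
        using evR ev\<delta>
      proof eventually_elim
        case (elim j)
        have "0 \<le> K * \<delta> j * (b - a)" using \<delta>0[of j] ab by (simp add: K_def)
        then show ?case using bound[OF elim] by (simp add: measure_def enn2real_leI)
      qed
      show "summable (\<lambda>j. K * \<delta> j * (b - a))"
        unfolding \<delta>_def using q by (intro summable_mult summable_mult2 summable_geometric) auto
    qed
  qed
  then show ?thesis
    by eventually_elim (auto elim!: eventually_mono)
qed

lemma AE_eventually_not_small:
  fixes v :: "nat \<Rightarrow> real"
  assumes "0 < n" "0 < s" "\<And>k. 0 < k \<Longrightarrow> k \<le> n + 1 \<Longrightarrow> s \<le> (\<Sum>i<k. v i)" "0 < c"
  shows "AE x in lborel. \<forall>\<^sub>F j in sequentially.
    x \<notin> small_at n (\<lambda>i. c * (2 ^ j) powr (- v i)) (integral_polys n)"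
proof -
  have "AE x in lborel. \<forall>N :: nat. x \<in> {- real (Suc N)..real (Suc N)} \<longrightarrow>
      (\<forall>\<^sub>F j in sequentially. x \<notin> small_at n (\<lambda>i. c * (2 ^ j) powr (- v i)) (integral_polys n))"
    unfolding AE_all_countable using AE_interval_eventually_not_small[OF assms] by simp
  then show ?thesis
  proof eventually_elim
    case (elim x)
    obtain N where "\<bar>x\<bar> \<le> real N" using real_arch_simple by blast
    then have "x \<in> {- real (Suc N)..real (Suc N)}" by auto
    then show ?case using elim by blast
  qed
qed

theorem theorem4:
  fixes n m :: nat and v :: "nat \<Rightarrow> real"
  assumes "n \<ge> 2"
    and "0 < m" and "m \<le> n"
    and "\<And>i. i < m \<Longrightarrow> v i \<ge> 0"
    and "\<And>i. m \<le> i \<Longrightarrow> i \<le> n \<Longrightarrow> v i \<le> 0"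
    and "v 0 > 0" and "v n < 0"
    and "(\<Sum>i=0..n. v i) > 0"
  shows "AE x in lebesgue. finite {Q::nat. Q > 0 \<and>
           (\<exists>P::int poly. P \<noteq> 0 \<and> degree P \<le> n \<and>
             (\<forall>i\<le>n. \<bar>poly ((pderiv ^^ i) (map_poly real_of_int P)) x\<bar>
                < real Q powr (- v i)))}"
proof -
  define s where "s = Min ((\<lambda>k. \<Sum>i<k. v i) ` {1..n + 1})"
  have s: "0 < s" "\<And>k. 0 < k \<Longrightarrow> k \<le> n + 1 \<Longrightarrow> s \<le> (\<Sum>i<k. v i)"
  proof -
    have "s \<in> (\<lambda>k. \<Sum>i<k. v i) ` {1..n + 1}" unfolding s_def by (intro Min_in) auto
    then show "0 < s" using partial_sums_pos[of m v n] assms by auto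
    show "s \<le> (\<Sum>i<k. v i)" if "0 < k" "k \<le> n + 1" for k
      unfolding s_def using that by (intro Min_le) auto
  qed
  \<comment> \<open>The factor \<open>c\<close> absorbs the passage from \<open>Q\<close> to the largest power of 2 below it.\<close>
  define c where "c = 2 powr (\<Sum>i\<le>n. \<bar>v i\<bar>)"
  have c: "0 < c" by (simp add: c_def)
  have compare: "real Q powr (- v i) \<le> c * (2 ^ j) powr (- v i)"
    if Q: "2 ^ j \<le> Q" "Q < 2 ^ (j + 1)" and i: "i \<le> n" for Q j i :: nat
  proof -
    define t where "t = real Q / 2 ^ j"
    have "real (2 ^ j) \<le> real Q" "real Q < real (2 ^ (j + 1))" using Q by (simp_all only: of_nat_le_iff of_nat_less_iff)
    then have t: "1 \<le> t" "t \<le> 2" by (auto simp: t_def field_simps)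
    have "real Q = t * 2 ^ j" by (simp add: t_def)
    then have "real Q powr (- v i) = t powr (- v i) * (2 ^ j) powr (- v i)"
      using t by (simp add: powr_mult)
    also have "t powr (- v i) \<le> t powr \<bar>v i\<bar>" using t by (intro powr_mono) auto
    also have "t powr \<bar>v i\<bar> \<le> 2 powr \<bar>v i\<bar>" using t by (intro powr_mono2) auto
    also have "2 powr \<bar>v i\<bar> \<le> c" unfolding c_def
      using i by (intro powr_mono member_le_sum[of i "{..n}" "\<lambda>i. \<bar>v i\<bar>"]) auto
    finally show ?thesis by (simp add: mult_right_mono)
  qed
  have "AE x in lborel. \<forall>\<^sub>F j in sequentially.
      x \<notin> small_at n (\<lambda>i. c * (2 ^ j) powr (- v i)) (integral_polys n)"
    using AE_eventually_not_small[OF _ s c] assms(1) by simp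
  then have "AE x in lborel. finite {Q::nat. Q > 0 \<and>
           (\<exists>P::int poly. P \<noteq> 0 \<and> degree P \<le> n \<and>
             (\<forall>i\<le>n. \<bar>poly ((pderiv ^^ i) (map_poly real_of_int P)) x\<bar>
                < real Q powr (- v i)))}"
  proof eventually_elim
    case (elim x)
    then obtain J where J: "\<And>j. J \<le> j \<Longrightarrow> x \<notin> small_at n (\<lambda>i. c * (2 ^ j) powr (- v i)) (integral_polys n)"
      unfolding eventually_sequentially by blast
    have "Q < 2 ^ J" if "0 < Q" and P: "P \<noteq> 0" "degree P \<le> n"
      "\<forall>i\<le>n. \<bar>poly ((pderiv ^^ i) (map_poly real_of_int P)) x\<bar> < real Q powr (- v i)"
      for Q :: nat and P :: "int poly"
    proof (rule ccontr)
      assume "\<not> Q < 2 ^ J"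
      obtain j where j: "2 ^ j \<le> Q" "Q < 2 ^ (j + 1)"
        using ex_power_ivl1[of 2 Q] \<open>0 < Q\<close> by auto
      have "(2::nat) ^ J < 2 ^ (j + 1)" using j(2) \<open>\<not> Q < 2 ^ J\<close> by simp
      then have "J < j + 1" by (rule power_less_imp_less_exp[rotated]) simp
      then have "J \<le> j" by simp
      define p where "p = map_poly real_of_int P"
      have "p \<in> integral_polys n"
        using P(2) by (auto simp: p_def integral_polys_def integral_coeffs_def coeff_map_poly degree_map_poly)
      moreover have "p \<noteq> 0" using P(1) by (simp add: p_def map_poly_eq_0_iff)
      moreover have "\<bar>poly ((pderiv ^^ i) p) x\<bar> < c * (2 ^ j) powr (- v i)" if "i \<le> n" for i
        using P(3) compare[OF j that] that unfolding p_def by (meson less_le_trans)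
      ultimately have "x \<in> small_at n (\<lambda>i. c * (2 ^ j) powr (- v i)) (integral_polys n)"
        unfolding small_at_def by blast
      then show False using J[OF \<open>J \<le> j\<close>] by simp
    qed
    then have "{Q::nat. Q > 0 \<and> (\<exists>P::int poly. P \<noteq> 0 \<and> degree P \<le> n \<and>
             (\<forall>i\<le>n. \<bar>poly ((pderiv ^^ i) (map_poly real_of_int P)) x\<bar> < real Q powr (- v i)))} \<subseteq> {..<2 ^ J}"
      by auto
    then show ?case by (rule finite_subset) simp
  qed
  then show ?thesis by (rule AE_completion)
qed

end
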